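(* Let $B:\mathbb{N}\to R$ be a map with $B(n)\ne0$ for all $n$ such that for all $n,m,s\in\mathbb{N}$: (a) $\displaystyle\frac{B(n+mp^{s+1})}{\varphi\big(B([\frac np]+mp^s)\big)}\equiv\frac{B(n)}{\varphi\big(B([\frac np])\big)}\mod[p^{s+1}]_qR$; (b) $\displaystyle\frac{B(n)}{\varphi\big(B([\frac np])\big)}\in R$; (d$'$) $B(0)=1$. Put $F(\lambda)=\sum_{j\ge0}B(j)\lambda^j$, $F_s(\lambda)=\sum_{j=0}^{p^s-1}B(j)\lambda^j$ for $s\ge0$, and $T=R\big\langle\lambda,\frac1{F_1(\lambda)}\big\rangle$. Then $$\frac{F_{s+1}(\lambda)}{\varphi(F_s(\lambda))}$$ converges, as $s\to\infty$, to an element of $T^\times$.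
   Context: $p$ is an odd prime, $q$ a formal variable, $R=\mathbb{Z}_p[[q-1]]$, $\mathbb{N}=\{0,1,2,\dots\}$. $[n]_q=\frac{q^n-1}{q-1}$ for a positive integer $n$; $[\frac np]$ (without subscript) is the integer part. $\varphi$ is the continuous endomorphism of $R[[\lambda]]$ with $\varphi(a)=a$ ($a\in\mathbb{Z}_p$), $\varphi(q)=q^p$, $\varphi(\lambda)=\lambda^p$, extended to fractions. For $g\in R[\lambda]\setminus(p,q-1)R[\lambda]$, $R\langle\lambda,\frac1{g(\lambda)}\rangle$ denotes the $(p,q-1)$-adic completion of $R[\lambda,\frac1{g(\lambda)}]$; since $F_1(0)=1$, $T$ is naturally a subring of $R[[\lambda]]$. Convergence is for the $(p,q-1)$-adic topology. *)

theory Defs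
  imports
    "HOL-Computational_Algebra.Computational_Algebra"
    "Berlekamp_Zassenhaus.Finite_Field"
begin

section \<open>The ring of p-adic integers\<close>

text \<open>
  The prime \<open>p\<close> is the cardinality of the type argument \<open>'p :: prime_card\<close>. The p-adic integers are
  the inverse limit of the rings \<open>\<int>/p\<^sup>n\<close>, the residue class modulo \<open>p\<^sup>n\<close> being represented
  by its least non-negative representative.
\<close>

typedef (overloaded) 'p padic_int =
  "{f :: nat \<Rightarrow> int. \<forall>n. 0 \<le> f n \<and> f n < int CARD('p::prime_card) ^ n
      \<and> f (Suc n) mod int CARD('p) ^ n = f n}"
  by (rule exI[of _ "\<lambda>_. 0"]) (simp add: prime_gt_0_nat prime_card)

setup_lifting type_definition_padic_int

lemma padic_card_pos [simp]: "int CARD('p::prime_card) ^ n > 0"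
  by (simp add: prime_gt_0_nat prime_card)

lemma padic_mod_mod [simp]:
  "(x::int) mod int CARD('p::prime_card) ^ Suc n mod int CARD('p) ^ n = x mod int CARD('p) ^ n"
  by (rule mod_mod_cancel) simp

lemma padic_coherent_mod:
  assumes "\<forall>n. 0 \<le> f n \<and> f n < int CARD('p::prime_card) ^ n \<and> f (Suc n) mod int CARD('p) ^ n = f n"
  shows "f (n + k) mod int CARD('p) ^ n = f n"
proof (induction k)
  case 0
  then show ?case using assms by simp
next
  case (Suc k)
  have "f (n + Suc k) mod int CARD('p) ^ n
      = f (Suc (n + k)) mod int CARD('p) ^ (n + k) mod int CARD('p) ^ n"
    by (simp add: mod_mod_cancel le_imp_power_dvd)
  also have "\<dots> = f (n + k) mod int CARD('p) ^ n"
    using assms by simp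
  finally show ?case using Suc by simp
qed

instantiation padic_int :: (prime_card) comm_ring_1
begin

lift_definition zero_padic_int :: "'a padic_int" is "\<lambda>_. 0" by simp

lift_definition one_padic_int :: "'a padic_int" is "\<lambda>n. 1 mod int CARD('a) ^ n"
  by (simp del: power_Suc)

lift_definition plus_padic_int :: "'a padic_int \<Rightarrow> 'a padic_int \<Rightarrow> 'a padic_int"
  is "\<lambda>f g n. (f n + g n) mod int CARD('a) ^ n"
  by (simp del: power_Suc) (metis mod_add_eq)

lift_definition times_padic_int :: "'a padic_int \<Rightarrow> 'a padic_int \<Rightarrow> 'a padic_int"
  is "\<lambda>f g n. (f n * g n) mod int CARD('a) ^ n"
  by (simp del: power_Suc) (metis mod_mult_eq)

lift_definition uminus_padic_int :: "'a padic_int \<Rightarrow> 'a padic_int"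
  is "\<lambda>f n. (- f n) mod int CARD('a) ^ n"
  by (simp del: power_Suc) (metis mod_minus_eq)

lift_definition minus_padic_int :: "'a padic_int \<Rightarrow> 'a padic_int \<Rightarrow> 'a padic_int"
  is "\<lambda>f g n. (f n - g n) mod int CARD('a) ^ n"
  by (simp del: power_Suc) (metis mod_diff_eq)

instance
proof
  fix a b c :: "'a padic_int"
  show "a * b * c = a * (b * c)"
    by transfer (simp add: fun_eq_iff mod_mult_left_eq mod_mult_right_eq mult.assoc)
  show "a * b = b * a"
    by transfer (simp add: mult.commute)
  show "1 * a = a"
    by transfer (simp add: fun_eq_iff mod_mult_left_eq)
  show "a + b + c = a + (b + c)"
    by transfer (simp add: fun_eq_iff mod_add_left_eq mod_add_right_eq add.assoc)
  show "a + b = b + a"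
    by transfer (simp add: add.commute)
  show "0 + a = a"
    by transfer (simp add: fun_eq_iff)
  show "- a + a = 0"
    by transfer (simp add: fun_eq_iff mod_add_left_eq)
  show "a - b = a + - b"
    by transfer (simp add: fun_eq_iff mod_add_right_eq)
  show "(a + b) * c = a * c + b * c"
    by transfer (simp add: fun_eq_iff mod_mult_left_eq mod_add_eq distrib_right)
  show "(0 :: 'a padic_int) \<noteq> 1"
  proof (transfer, rule notI)
    assume "(\<lambda>_::nat. 0::int) = (\<lambda>n. 1 mod int CARD('a) ^ n)"
    then have "(0::int) = 1 mod int CARD('a) ^ 1" by (rule fun_cong)
    moreover have "int CARD('a) > 1" using prime_gt_1_nat[OF prime_card] by simp
    ultimately show False by simp
  qed
qed

end

instance padic_int :: (prime_card) idom
proof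
  fix a b :: "'a padic_int"
  assume "a \<noteq> 0" "b \<noteq> 0"
  then show "a * b \<noteq> 0"
  proof transfer
    fix f g :: "nat \<Rightarrow> int"
    let ?p = "int CARD('a)"
    assume f: "\<forall>n. 0 \<le> f n \<and> f n < ?p ^ n \<and> f (Suc n) mod ?p ^ n = f n"
      and g: "\<forall>n. 0 \<le> g n \<and> g n < ?p ^ n \<and> g (Suc n) mod ?p ^ n = g n"
      and "f \<noteq> (\<lambda>_. 0)" "g \<noteq> (\<lambda>_. 0)"
    then obtain m n where m: "f m \<noteq> 0" and n: "g n \<noteq> 0"
      unfolding fun_eq_iff by blast
    have pp: "prime ?p" using prime_card by simp
    have 1: "\<not> ?p ^ m dvd f (m + n)"
      using padic_coherent_mod[OF f, of m n] m by auto
    have 2: "\<not> ?p ^ n dvd g (m + n)"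
      using padic_coherent_mod[OF g, of n m] n by (auto simp: add.commute)
    have nz: "f (m + n) \<noteq> 0" "g (m + n) \<noteq> 0" using 1 2 by auto
    have "multiplicity ?p (f (m + n)) < m" "multiplicity ?p (g (m + n)) < n"
      using 1 2 by (meson multiplicity_dvd' not_le)+
    then have "multiplicity ?p (f (m + n) * g (m + n)) < m + n"
      using nz pp by (simp add: prime_elem_multiplicity_mult_distrib)
    then have "\<not> ?p ^ (m + n) dvd f (m + n) * g (m + n)"
      using nz pp by (metis mult_eq_0_iff multiplicity_geI not_le not_prime_unit)
    then have "(f (m + n) * g (m + n)) mod ?p ^ (m + n) \<noteq> 0"
      by (simp add: dvd_eq_mod_eq_0)
    then show "(\<lambda>n. (f n * g n) mod ?p ^ n) \<noteq> (\<lambda>_. 0)" by (metis (mono_tags))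
  qed
qed


section \<open>The ring R and its Frobenius lift\<close>

text \<open>The power series variable of \<open>R = \<int>\<^sub>p[[q-1]]\<close> is \<open>q - 1\<close>.\<close>

type_synonym 'p qring = "'p padic_int fps"

definition qvar :: "'p::prime_card qring" where
  "qvar = 1 + fps_X"

definition qbracket :: "nat \<Rightarrow> 'p::prime_card qring fract" where
  "qbracket n = (to_fract qvar ^ n - 1) / (to_fract qvar - 1)"

text \<open>The substitution \<open>q - 1 \<mapsto> q\<^sup>p - 1\<close>.\<close>

definition phi :: "'p::prime_card qring \<Rightarrow> 'p qring" where
  "phi f = f oo (qvar ^ CARD('p) - 1)"

text \<open>The extension of \<^const>\<open>phi\<close> to \<open>R[[\<lambda>]]\<close> with \<open>\<lambda> \<mapsto> \<lambda>\<^sup>p\<close>.\<close>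

definition phi_lambda :: "'p::prime_card qring fps \<Rightarrow> 'p qring fps" where
  "phi_lambda F = Abs_fps (\<lambda>n. phi (F $ n)) oo fps_X ^ CARD('p)"

lemma phi_qvar: "phi (qvar :: 'p::prime_card qring) = qvar ^ CARD('p)"
proof -
  have "(qvar ^ CARD('p) - 1 :: 'p qring) $ 0 = 0"
    by (simp add: qvar_def fps_nth_power_0)
  then show ?thesis
    by (simp add: phi_def fps_compose_add_distrib qvar_def)
qed

lemma phi_const: "phi (fps_const a) = fps_const a"
  by (simp add: phi_def)

lemma phi_lambda_fps_X: "phi_lambda (fps_X :: 'p::prime_card qring fps) = fps_X ^ CARD('p)"
proof -
  have "Abs_fps (\<lambda>n. phi ((fps_X :: 'p qring fps) $ n)) = fps_X"
    by (rule fps_ext) (simp add: phi_def fps_X_def)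
  then show ?thesis
    by (simp add: phi_lambda_def fps_X_fps_compose_startby0 fps_nth_power_0 zero_power
        prime_gt_0_nat prime_card)
qed


section \<open>Completed localizations inside \<open>R[[\<lambda>]]\<close>\<close>

text \<open>
  \<open>pq_power k S\<close> is the ideal \<open>(p, q-1)\<^sup>k S\<close> of a subring \<open>S \<supseteq> R\<close> of \<open>R[[\<lambda>]]\<close>; the \<open>k\<close>-th power of
  \<open>(p, q-1)\<close> is generated by the products \<open>p\<^sup>i (q-1)\<^bsup>k-i\<^esup>\<close>.
\<close>

definition pq_power :: "nat \<Rightarrow> 'p::prime_card qring fps set \<Rightarrow> 'p qring fps set" where
  "pq_power k S =
     {\<Sum>i\<le>k. of_nat CARD('p) ^ i * fps_const (qvar - 1) ^ (k - i) * t i | t. \<forall>i. t i \<in> S}"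

text \<open>
  The localization \<open>R[\<lambda>, 1/g(\<lambda>)]\<close>, for \<open>g\<close> with \<open>g(0)\<close> a unit of \<open>R\<close>: such a \<open>g\<close> is invertible in
  \<open>R[[\<lambda>]]\<close>, and the fraction \<open>h/g\<^sup>k\<close> is the power series \<open>x\<close> with \<open>x g\<^sup>k = h\<close>.
\<close>

definition localized :: "'p::prime_card qring poly \<Rightarrow> 'p qring fps set" where
  "localized g = {x. \<exists>h k. x * fps_of_poly g ^ k = fps_of_poly h}"

text \<open>
  The \<open>(p, q-1)\<close>-adic completion \<open>R\<langle>\<lambda>, 1/g(\<lambda>)\<rangle>\<close> of \<open>A = R[\<lambda>, 1/g(\<lambda>)]\<close>, for \<open>g(0)\<close> a unit. An element of
  \<open>lim A/(p,q-1)\<^sup>n A\<close> is given by a sequence \<open>a\<close> in \<open>A\<close> with \<open>a (n+1) \<equiv> a n\<close> modulo \<open>(p,q-1)\<^sup>n A\<close>, and it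
  is identified with the limit of \<open>a\<close> in the \<open>(p,q-1)\<close>-adically complete ring \<open>R[[\<lambda>]]\<close>. By the
  lemma \<open>localized_pq_power\<close> below this identification is injective, and the topology of \<open>A\<close> is the
  one induced from \<open>R[[\<lambda>]]\<close>.
\<close>

definition completed :: "'p::prime_card qring poly \<Rightarrow> 'p qring fps set" where
  "completed g = {x. \<exists>a. \<forall>n. a n \<in> localized g
     \<and> a (Suc n) - a n \<in> pq_power n (localized g) \<and> x - a n \<in> pq_power n UNIV}"

lemma localized_pq_power:
  fixes g :: "'p::prime_card qring poly"
  assumes g0: "poly.coeff g 0 dvd 1"
    and x: "x \<in> localized g"
  shows "x \<in> pq_power n UNIV \<longleftrightarrow> x \<in> pq_power n (localized g)"
proof
  assume "x \<in> pq_power n (localized g)"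
  then show "x \<in> pq_power n UNIV" unfolding pq_power_def by auto
next
  assume "x \<in> pq_power n UNIV"
  define c :: "nat \<Rightarrow> 'p qring" where "c i = of_nat CARD('p) ^ i * (qvar - 1) ^ (n - i)" for i
  have c: "of_nat CARD('p) ^ i * fps_const (qvar - 1) ^ (n - i) = fps_const (c i)" for i
    by (simp add: c_def fps_of_nat[symmetric] fps_const_power)
  from \<open>x \<in> pq_power n UNIV\<close> obtain t where t: "x = (\<Sum>i\<le>n. fps_const (c i) * t i)"
    unfolding pq_power_def c by auto
  from x obtain h k where hk: "x * fps_of_poly g ^ k = fps_of_poly h"
    by (auto simp: localized_def)
  from g0 obtain y where y: "poly.coeff g 0 * y = 1" by (metis dvdE)
  define G where "G = fps_of_poly g ^ k"
  have "G $ 0 * y ^ k = 1"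
    using y by (simp add: G_def fps_nth_power_0 power_mult_distrib[symmetric])
  then obtain v where v: "G * v = 1"
    using fps_right_inverse by blast
  define d where "d = Suc (degree h)"
  define r where "r i = fps_of_poly (truncate_fps d (t i * G)) * v" for i
  have r: "r i \<in> localized g" for i
  proof -
    have "r i * G = fps_of_poly (truncate_fps d (t i * G))"
      using v by (simp add: r_def mult.assoc mult.commute[of v])
    then show ?thesis unfolding localized_def G_def by blast
  qed
  have h: "fps_of_poly h = (\<Sum>i\<le>n. fps_const (c i) * (t i * G))"
    using hk by (simp add: t G_def[symmetric] sum_distrib_right mult.assoc)
  have "fps_of_poly h = (\<Sum>i\<le>n. fps_const (c i) * fps_of_poly (truncate_fps d (t i * G)))"
  proof (rule fps_ext)
    fix j
    show "fps_of_poly h $ j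
        = (\<Sum>i\<le>n. fps_const (c i) * fps_of_poly (truncate_fps d (t i * G))) $ j"
    proof (cases "j < d")
      case True
      have "fps_of_poly h $ j = (\<Sum>i\<le>n. fps_const (c i) * (t i * G)) $ j" by (simp only: h)
      then show ?thesis using True by (simp add: fps_sum_nth coeff_truncate_fps)
    next
      case False
      then show ?thesis by (simp add: fps_sum_nth coeff_truncate_fps d_def coeff_eq_0)
    qed
  qed
  moreover have "x = fps_of_poly h * v"
    using hk v by (simp add: G_def[symmetric] mult.assoc flip: hk)
  ultimately have "x = (\<Sum>i\<le>n. fps_const (c i) * r i)"
    by (simp add: r_def sum_distrib_right mult.assoc)
  then show "x \<in> pq_power n (localized g)"
    unfolding pq_power_def c using r by blast
qed

definition units_of_subring :: "'a::comm_ring_1 set \<Rightarrow> 'a set" where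
  "units_of_subring S = {x \<in> S. \<exists>y\<in>S. x * y = 1}"

definition pq_converges_in ::
  "'p::prime_card qring fps set \<Rightarrow> (nat \<Rightarrow> 'p qring fps) \<Rightarrow> 'p qring fps \<Rightarrow> bool" where
  "pq_converges_in S u L \<longleftrightarrow> (\<forall>s. u s \<in> S) \<and> L \<in> S
     \<and> (\<forall>k. \<forall>\<^sub>F s in sequentially. u s - L \<in> pq_power k S)"

definition trunc_series :: "(nat \<Rightarrow> 'p::prime_card qring) \<Rightarrow> nat \<Rightarrow> 'p qring poly" where
  "trunc_series B s = (\<Sum>j<CARD('p) ^ s. Polynomial.monom (B j) j)"

end

theory Submission
  imports Defs
begin

text \<open>
  Put \<open>A(n) = B(n) / \<phi>(B([n/p]))\<close> and let \<open>I\<close> be the ideal generated by \<open>p\<close> and \<open>q-1\<close>. The hypotheses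
  say that \<open>A\<close> takes values in \<open>R\<close> and that \<open>A(n + m p\<^sup>j) \<equiv> A(n)\<close> modulo \<open>[p\<^sup>j]\<^sub>q\<close>, which lies in \<open>I\<^sup>j\<close>
  (\<open>qbracket_p_power\<close>); so \<open>A\<close> is p-adically continuous. Since \<open>B(n)\<close> is the product of the
  \<open>\<phi>\<^sup>k(A([n/p\<^sup>k]))\<close>, the truncations \<open>F\<^sub>s\<close> are sums over digit sequences in which every digit contributes
  a factor. Summing over the lowest digit first writes such sums as iterated transfer operators. With
  \<open>h(m) = \<Sum>\<^sub>a A(a + p m) \<lambda>\<^sup>a\<close>, where \<open>a\<close> runs over the digits, \<open>F\<^bsub>s+1\<^esub>\<close> and \<open>\<phi>(F\<^sub>s)\<close> are the same
  \<open>s\<close>-digit sum over \<open>m < p\<^sup>s\<close>, taken of \<open>h\<close> and of the constant function \<open>1\<close>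
  (\<open>transfer_sum_digit_weight\<close>).

  A transfer operator improves continuity by one power of \<open>I\<close>, as two numbers with equal lowest digit
  are p-adically closer than their quotients by \<open>p\<close> (\<open>transfer_op_continuous\<close>). Hence, by induction
  on the number of digits, the quotients of the \<open>s\<close>-digit sums of \<open>h\<close> and \<open>1\<close> change by elements of
  \<open>I\<^bsup>s+1\<^esup>\<close> from \<open>s\<close> to \<open>s+1\<close> (\<open>transfer_sum_contraction\<close>). These are congruences in \<open>R[[\<lambda>]]\<close>, where every
  series with constant coefficient \<open>1\<close> is invertible, and \<open>R[[\<lambda>]]\<close> is complete (\<open>series_complete\<close>),
  so the quotients have a limit there.

  It remains to return to \<open>T\<close>, which is the closure of the localization in \<open>R[[\<lambda>]]\<close>
  (\<open>completed_iff\<close>) and carries the induced topology (\<open>completed_inter_series_ideal\<close>). Modulo \<open>I\<close> the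
  map \<open>\<phi>\<close> is the \<open>p\<close>-th power map and \<open>h\<close> is the constant \<open>F\<^sub>1\<close>, so
  \<open>F\<^bsub>s+1\<^esub> \<equiv> F\<^sub>1 \<phi>(F\<^sub>s) \<equiv> F\<^sub>1 F\<^sub>s\<^sup>p\<close>. By induction all \<open>F\<^sub>s\<close> and \<open>\<phi>(F\<^sub>s)\<close> are congruent to powers of
  the unit \<open>F\<^sub>1\<close> of \<open>T\<close>, and an element of \<open>T\<close> congruent to a unit modulo \<open>I\<close> is a unit
  (\<open>units_of_completed_lift\<close>). So all quotients and their limit are units of \<open>T\<close>.
\<close>

section \<open>Divisibility and completeness in the p-adic integers\<close>

lemma Rep_padic_bounds:
  fixes x :: "'p::prime_card padic_int"
  shows "0 \<le> Rep_padic_int x n" "Rep_padic_int x n < int CARD('p) ^ n"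
    and "Rep_padic_int x (n + k) mod int CARD('p) ^ n = Rep_padic_int x n"
  using Rep_padic_int[of x] padic_coherent_mod[of "Rep_padic_int x" n k] by auto

lemma Rep_padic_of_nat:
  "Rep_padic_int (of_nat m :: 'p::prime_card padic_int) n = int m mod int CARD('p) ^ n"
proof (induction m)
  case 0
  then show ?case by (simp add: zero_padic_int.rep_eq)
next
  case (Suc m)
  then show ?case
    by (simp add: plus_padic_int.rep_eq one_padic_int.rep_eq mod_add_eq)
qed

text \<open>
  Divisibility by \<open>p\<^sup>m\<close> can be read off from a single residue, since the quotient of a coherent
  sequence that vanishes at level \<open>m\<close> is the sequence shifted by \<open>m\<close> and divided by \<open>p\<^sup>m\<close>.
\<close>

lemma p_power_dvd_iff_Rep:
  fixes x :: "'p::prime_card padic_int"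
  shows "of_nat CARD('p) ^ m dvd x \<longleftrightarrow> Rep_padic_int x m = 0"
proof
  assume "of_nat CARD('p) ^ m dvd x"
  then obtain c where "x = of_nat CARD('p) ^ m * c" ..
  then have "x = of_nat (CARD('p) ^ m) * c" by simp
  then have "Rep_padic_int x m = int (CARD('p) ^ m) * Rep_padic_int c m mod int CARD('p) ^ m"
    by (simp only: times_padic_int.rep_eq Rep_padic_of_nat mod_mult_left_eq)
  then show "Rep_padic_int x m = 0" by simp
next
  let ?p = "int CARD('p)"
  assume 0: "Rep_padic_int x m = 0"
  define b where "b n = Rep_padic_int x (n + m) div ?p ^ m" for n
  have dvd: "?p ^ m dvd Rep_padic_int x (n + m)" for n
    using Rep_padic_bounds(3)[of x m n] 0 by (simp add: add.commute dvd_eq_mod_eq_0)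
  have "\<forall>n. 0 \<le> b n \<and> b n < ?p ^ n \<and> b (Suc n) mod ?p ^ n = b n"
  proof (intro allI conjI)
    fix n
    show "0 \<le> b n" unfolding b_def using Rep_padic_bounds(1)[of x] by (simp add: pos_imp_zdiv_nonneg_iff)
    have "Rep_padic_int x (n + m) < ?p ^ n * ?p ^ m"
      using Rep_padic_bounds(2)[of x "n + m"] by (simp add: power_add)
    then show "b n < ?p ^ n"
      unfolding b_def using dvd[of n] by (auto simp: mult.commute)
    obtain c where c: "Rep_padic_int x (Suc n + m) = ?p ^ m * c" using dvd by blast
    then have "b (Suc n) mod ?p ^ n = ?p ^ m * (c mod ?p ^ n) div ?p ^ m"
      by (simp add: b_def)
    also have "?p ^ m * (c mod ?p ^ n) = Rep_padic_int x (Suc n + m) mod ?p ^ (n + m)"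
      by (simp only: c mult_mod_right power_add mult.commute)
    also have "\<dots> = Rep_padic_int x (n + m)"
      using Rep_padic_bounds(3)[of x "n + m" 1] by simp
    also have "\<dots> div ?p ^ m = b n" by (simp only: b_def)
    finally show "b (Suc n) mod ?p ^ n = b n" .
  qed
  then have Rep: "Rep_padic_int (Abs_padic_int b :: 'p padic_int) = b"
    by (intro Abs_padic_int_inverse) simp
  have "Rep_padic_int (of_nat (CARD('p) ^ m) * Abs_padic_int b :: 'p padic_int) n
      = Rep_padic_int x n" for n
  proof -
    have "Rep_padic_int (of_nat (CARD('p) ^ m) * Abs_padic_int b :: 'p padic_int) n
        = (int (CARD('p) ^ m) * b n) mod ?p ^ n"
      by (simp only: times_padic_int.rep_eq Rep_padic_of_nat Rep mod_mult_left_eq)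
    also have "int (CARD('p) ^ m) = ?p ^ m" by simp
    also have "?p ^ m * b n = Rep_padic_int x (n + m)"
      unfolding b_def using dvd[of n] by simp
    finally show ?thesis by (simp add: Rep_padic_bounds(3))
  qed
  then have "of_nat (CARD('p) ^ m) * Abs_padic_int b = x"
    by (simp add: Rep_padic_int_inject[symmetric] fun_eq_iff)
  then show "of_nat CARD('p) ^ m dvd x" by (metis dvd_triv_left of_nat_power)
qed

lemma padic_separated:
  fixes x :: "'p::prime_card padic_int"
  assumes "\<And>n. of_nat CARD('p) ^ n dvd x"
  shows "x = 0"
  using assms by (simp add: p_power_dvd_iff_Rep Rep_padic_int_inject[symmetric] fun_eq_iff
      zero_padic_int.rep_eq)

text \<open>
  The limit takes its residue modulo \<open>p\<^sup>n\<close> from the \<open>n\<close>-th term, which all later terms agree with.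
\<close>

lemma padic_complete:
  fixes a :: "nat \<Rightarrow> 'p::prime_card padic_int"
  assumes "\<And>n. of_nat CARD('p) ^ n dvd a (Suc n) - a n"
  obtains x where "\<And>n. of_nat CARD('p) ^ n dvd x - a n"
proof -
  let ?p = "int CARD('p)"
  have eq_mod: "of_nat CARD('p) ^ n dvd x - y \<longleftrightarrow> Rep_padic_int x n = Rep_padic_int y n"
    for x y :: "'p padic_int" and n
  proof -
    have "of_nat CARD('p) ^ n dvd x - y
        \<longleftrightarrow> Rep_padic_int x n mod ?p ^ n = Rep_padic_int y n mod ?p ^ n"
      by (simp add: p_power_dvd_iff_Rep minus_padic_int.rep_eq mod_eq_dvd_iff dvd_eq_mod_eq_0)
    then show ?thesis by (simp add: Rep_padic_bounds)
  qed
  define b where "b n = Rep_padic_int (a n) n" for n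
  have "b (Suc n) mod ?p ^ n = b n" for n
    using assms[of n] Rep_padic_bounds(3)[of "a (Suc n)" n 1] by (simp add: eq_mod b_def)
  then have "\<forall>n. 0 \<le> b n \<and> b n < ?p ^ n \<and> b (Suc n) mod ?p ^ n = b n"
    by (simp add: b_def Rep_padic_bounds)
  then have Rep: "Rep_padic_int (Abs_padic_int b :: 'p padic_int) = b"
    by (intro Abs_padic_int_inverse) simp
  show ?thesis
    by (rule that[of "Abs_padic_int b"]) (simp add: eq_mod Rep b_def)
qed

lemma of_nat_p_nonzero: "(of_nat CARD('p) :: 'p::prime_card padic_int) \<noteq> 0"
proof
  assume 0: "(of_nat CARD('p) :: 'p padic_int) = 0"
  have "CARD('p) > 1" using prime_gt_1_nat[OF prime_card] .
  moreover have "int CARD('p) mod int CARD('p) ^ 2 = 0"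
    using Rep_padic_of_nat[of "CARD('p)" 2, where 'p='p] 0 by (simp add: zero_padic_int.rep_eq)
  then have "CARD('p) ^ 2 dvd CARD('p) ^ 1"
    by (metis dvd_eq_mod_eq_0 int_dvd_int_iff of_nat_power power_one_right)
  ultimately show False using power_dvd_imp_le by fastforce
qed

text \<open>
  Freshman's dream, as a divisibility: it is applied in rings of characteristic \<open>0\<close>, both to
  \<open>R[[\<lambda>]]\<close> and, with all summands equal to \<open>1\<close>, to derive Fermat's little theorem below.
\<close>

lemma prime_dvd_power_add:
  fixes x y :: "'a::comm_ring_1"
  assumes "prime p"
  shows "of_nat p dvd (x + y) ^ p - (x ^ p + y ^ p)"
proof -
  have p: "p > 0" using assms by (simp add: prime_gt_0_nat)
  have "(x + y) ^ p = (\<Sum>k\<in>insert 0 (insert p {0<..<p}). of_nat (p choose k) * x ^ k * y ^ (p - k))"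
    unfolding binomial_ring using p by (intro sum.cong) auto
  also have "\<dots> = y ^ p + (x ^ p + (\<Sum>k\<in>{0<..<p}. of_nat (p choose k) * x ^ k * y ^ (p - k)))"
    using p by simp
  finally have "(x + y) ^ p - (x ^ p + y ^ p)
      = (\<Sum>k\<in>{0<..<p}. of_nat (p choose k) * x ^ k * y ^ (p - k))" by simp
  moreover have "of_nat p dvd (of_nat (p choose k) :: 'a)" if "k \<in> {0<..<p}" for k
  proof -
    have "p dvd p choose k" using that assms by (intro dvd_choose_prime) auto
    then show ?thesis by (auto elim!: dvdE)
  qed
  ultimately show ?thesis by (auto intro!: dvd_sum dvd_mult2)
qed

lemma prime_dvd_power_sum:
  fixes f :: "'b \<Rightarrow> 'a::comm_ring_1"
  assumes "prime p"
  shows "of_nat p dvd (\<Sum>i\<in>S. f i) ^ p - (\<Sum>i\<in>S. f i ^ p)"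
proof (cases "finite S")
  case True
  then show ?thesis
  proof (induction S)
    case empty
    then show ?case using assms by (simp add: prime_gt_0_nat zero_power)
  next
    case (insert i S)
    from dvd_add[OF prime_dvd_power_add[OF assms, of "f i" "sum f S"] insert.IH] insert.hyps
    show ?case by (simp add: algebra_simps)
  qed
qed (use assms in \<open>simp add: prime_gt_0_nat zero_power\<close>)

lemma padic_fermat: "of_nat CARD('p) dvd (a :: 'p::prime_card padic_int) ^ CARD('p) - a"
proof -
  let ?P = "of_nat CARD('p) :: 'p padic_int"
  \<comment> \<open>The residue field is the prime field, so \<open>a\<close> is congruent to a natural number.\<close>
  define n where "n = nat (Rep_padic_int a 1)"
  have "int n = Rep_padic_int a 1" by (simp add: n_def Rep_padic_bounds)
  then have "Rep_padic_int (a - of_nat n) 1 = 0"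
    using Rep_padic_bounds(1,2)[of a 1]
    by (simp add: minus_padic_int.rep_eq Rep_padic_of_nat)
  then have n: "?P dvd a - of_nat n"
    using p_power_dvd_iff_Rep[of 1 "a - of_nat n"] by simp
  have "?P dvd a ^ CARD('p) - of_nat n ^ CARD('p)"
    using n power_diff_sumr2[of a "CARD('p)" "of_nat n"] by auto
  moreover have "?P dvd of_nat n ^ CARD('p) - of_nat n"
    using prime_dvd_power_sum[OF prime_card[where 'a='p], of "\<lambda>_. 1 :: 'p padic_int" "{..<n}"]
    by simp
  ultimately have "?P dvd (a ^ CARD('p) - of_nat n ^ CARD('p)) + (of_nat n ^ CARD('p) - of_nat n)"
    by (rule dvd_add)
  from dvd_diff[OF this n] show ?thesis by simp
qed

section \<open>The \<open>(p, q-1)\<close>-adic filtrations of \<open>R\<close> and \<open>R[[\<lambda>]]\<close>\<close>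

text \<open>
  Write \<open>I\<close> for the ideal generated by \<open>p\<close> and \<open>q-1\<close>. A power series in \<open>q-1\<close> lies in \<open>I\<^sup>k R\<close> iff its
  \<open>i\<close>-th coefficient is divisible by \<open>p\<^bsup>k-i\<^esup>\<close>; truncated subtraction leaves the coefficients from the
  \<open>k\<close>-th on unrestricted. The same description of \<open>I\<^sup>k R[[\<lambda>]]\<close>, coefficient by coefficient in \<open>\<lambda>\<close>,
  turns completeness into completeness of the p-adic integers; that it is the ideal power in the
  sense of \<^const>\<open>pq_power\<close> is the lemma \<open>pq_power_UNIV\<close>.
\<close>

definition base_ideal :: "nat \<Rightarrow> 'p::prime_card qring set" where
  "base_ideal k = {f. \<forall>i. of_nat CARD('p) ^ (k - i) dvd f $ i}"

definition series_ideal :: "nat \<Rightarrow> 'p::prime_card qring fps set" where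
  "series_ideal k = {x. \<forall>j. x $ j \<in> base_ideal k}"

lemma base_ideal_0 [simp]: "f \<in> base_ideal 0"
  by (simp add: base_ideal_def)

lemma base_ideal_zero [simp]: "0 \<in> base_ideal k"
  by (simp add: base_ideal_def)

lemma base_ideal_add: "f \<in> base_ideal k \<Longrightarrow> g \<in> base_ideal k \<Longrightarrow> f + g \<in> base_ideal k"
  by (simp add: base_ideal_def)

lemma base_ideal_diff: "f \<in> base_ideal k \<Longrightarrow> g \<in> base_ideal k \<Longrightarrow> f - g \<in> base_ideal k"
  by (simp add: base_ideal_def)

lemma base_ideal_sum: "(\<And>i. i \<in> S \<Longrightarrow> f i \<in> base_ideal k) \<Longrightarrow> sum f S \<in> base_ideal k"
  by (induction S rule: infinite_finite_induct) (auto intro: base_ideal_add)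

lemma base_ideal_mono:
  assumes "l \<le> k" "f \<in> base_ideal k"
  shows "f \<in> base_ideal l"
  unfolding base_ideal_def
proof (intro CollectI allI)
  fix i
  have "of_nat CARD('a) ^ (l - i) dvd (of_nat CARD('a) ^ (k - i) :: 'a padic_int)"
    using assms(1) by (intro le_imp_power_dvd) simp
  also have "\<dots> dvd f $ i" using assms(2) by (simp add: base_ideal_def)
  finally show "of_nat CARD('a) ^ (l - i) dvd f $ i" .
qed

lemma base_ideal_mult:
  assumes "f \<in> base_ideal k" "g \<in> base_ideal l"
  shows "f * g \<in> base_ideal (k + l)"
  unfolding base_ideal_def
proof (intro CollectI allI)
  fix i
  let ?P = "of_nat CARD('a) :: 'a padic_int"
  have "?P ^ (k + l - i) dvd f $ j * g $ (i - j)" if "j \<le> i" for j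
  proof -
    have "?P ^ (k - j) * ?P ^ (l - (i - j)) dvd f $ j * g $ (i - j)"
      using assms by (intro mult_dvd_mono) (auto simp: base_ideal_def)
    then have "?P ^ (k - j + (l - (i - j))) dvd f $ j * g $ (i - j)" by (simp add: power_add)
    moreover have "?P ^ (k + l - i) dvd ?P ^ (k - j + (l - (i - j)))"
      using that by (intro le_imp_power_dvd) auto
    ultimately show ?thesis by (rule dvd_trans[rotated])
  qed
  then show "?P ^ (k + l - i) dvd (f * g) $ i"
    by (auto simp: fps_mult_nth intro!: dvd_sum)
qed

lemma base_ideal_mult_left: "g \<in> base_ideal k \<Longrightarrow> f * g \<in> base_ideal k"
  using base_ideal_mult[of f 0 g k] by simp

lemma base_ideal_1_iff: "f \<in> base_ideal 1 \<longleftrightarrow> of_nat CARD('p) dvd f $ 0"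
  for f :: "'p::prime_card qring"
proof
  assume "of_nat CARD('p) dvd f $ 0"
  then have "of_nat CARD('p) ^ (1 - i) dvd f $ i" for i by (cases i) auto
  then show "f \<in> base_ideal 1" by (simp add: base_ideal_def)
qed (auto simp: base_ideal_def dest: spec[of _ 0])

lemma phi_base: "(qvar ^ CARD('p) - 1 :: 'p::prime_card qring) $ 0 = 0"
  by (simp add: qvar_def fps_nth_power_0)

lemma phi_0 [simp]: "phi 0 = 0" and phi_1 [simp]: "phi 1 = 1"
  using phi_const[of 0] phi_const[of 1] by simp_all

lemma phi_diff: "phi (f - g) = phi f - phi g"
  by (simp add: phi_def fps_compose_sub_distrib)

lemma phi_mult: "phi (f * g) = phi f * phi g"
  unfolding phi_def by (rule fps_compose_mult_distrib[OF phi_base])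

lemma phi_nth_0: "phi f $ 0 = f $ 0"
  by (simp add: phi_def)

lemma phi_eq_0_iff [simp]: "phi f = 0 \<longleftrightarrow> f = 0" for f :: "'p::prime_card qring"
proof -
  have "(qvar ^ n :: 'p qring) $ 1 = of_nat n" for n
  proof (induction n)
    case (Suc n)
    have "(qvar ^ n :: 'p qring) $ 0 = 1" by (simp add: qvar_def fps_nth_power_0)
    with Suc show ?case by (simp add: fps_mult_nth_1) (simp add: qvar_def)
  qed simp
  then have "(qvar ^ CARD('p) - 1 :: 'p qring) $ 1 = of_nat CARD('p)" by simp
  then have "(qvar ^ CARD('p) - 1 :: 'p qring) \<noteq> 0"
    using of_nat_p_nonzero[where 'p='p] by (metis fps_zero_nth)
  then show ?thesis
    unfolding phi_def by (subst fps_compose_eq_0_iff[OF phi_base]) simp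
qed

text \<open>
  The \<open>n\<close>-th coefficient of \<open>phi f\<close> only involves the coefficients of \<open>f\<close> up to the \<open>n\<close>-th, and these
  are at least as divisible as required.
\<close>

lemma phi_base_ideal: "f \<in> base_ideal k \<Longrightarrow> phi f \<in> base_ideal k" for f :: "'p::prime_card qring"
proof -
  assume f: "f \<in> base_ideal k"
  have "of_nat CARD('p) ^ (k - n) dvd f $ i * x" if "i \<le> n" for i n x
  proof -
    have "of_nat CARD('p) ^ (k - n) dvd (of_nat CARD('p) ^ (k - i) :: 'p padic_int)"
      using that by (intro le_imp_power_dvd) auto
    also have "\<dots> dvd f $ i * x" using f by (simp add: base_ideal_def)
    finally show ?thesis .
  qed
  then have "of_nat CARD('p) ^ (k - n) dvd phi f $ n" for n
    unfolding phi_def fps_compose_nth by (intro dvd_sum) simp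
  then show ?thesis by (simp add: base_ideal_def)
qed

text \<open>
  Modulo \<open>I\<close> only the constant coefficient survives, which \<open>phi\<close> fixes and which is its own \<open>p\<close>-th
  power by Fermat.
\<close>

lemma phi_minus_power_in_base_ideal: "phi f - f ^ CARD('p) \<in> base_ideal 1" for f :: "'p::prime_card qring"
proof -
  have "of_nat CARD('p) dvd - ((f $ 0) ^ CARD('p) - f $ 0)"
    using padic_fermat[of "f $ 0"] by (simp only: dvd_minus_iff)
  then show ?thesis
    by (simp add: base_ideal_1_iff phi_nth_0 fps_nth_power_0 del: One_nat_def)
qed

text \<open>
  With \<open>Q = q ^ (p ^ s)\<close> one has \<open>[p ^ (s+1)]\<^sub>q = [p ^ s]\<^sub>q (1 + Q + \<dots> + Q ^ (p-1))\<close>. As \<open>Q \<equiv> 1\<close> modulo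
  \<open>q-1\<close>, the second factor is \<open>p\<close> modulo \<open>q-1\<close>, so that each step gains one power of \<open>I\<close>.
\<close>

lemma qbracket_p_power:
  obtains b :: "'p::prime_card qring"
  where "qbracket (CARD('p) ^ s) = to_fract b" "b \<in> base_ideal s"
proof -
  \<comment> \<open>\<open>S n k\<close> is the bracket \<open>[k]\<close> for the base \<open>q ^ n\<close>.\<close>
  define S :: "nat \<Rightarrow> nat \<Rightarrow> 'p qring" where "S n k = (\<Sum>i<k. (qvar ^ n) ^ i)" for n k
  have S: "(qvar ^ n - 1) * S n k = qvar ^ (n * k) - 1" for n k
    unfolding S_def by (simp add: power_diff_1_eq power_mult)
  have X: "(qvar - 1 :: 'p qring) = fps_X" by (simp add: qvar_def)
  then have "to_fract (qvar :: 'p qring) - 1 \<noteq> 0"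
    by (metis fps_X_neq_zero to_fract_1 to_fract_diff to_fract_eq_0_iff)
  moreover have "to_fract (qvar ^ m :: 'p qring) = to_fract qvar ^ m" for m
    by (induction m) auto
  then have "(to_fract (qvar :: 'p qring) - 1) * to_fract (S 1 n) = to_fract qvar ^ n - 1" for n
    using arg_cong[OF S[of 1 n], of to_fract] by simp
  ultimately have eq: "qbracket n = to_fract (S 1 n)" for n
    unfolding qbracket_def by (metis nonzero_mult_div_cancel_left)
  have "S 1 (CARD('p) ^ s) \<in> base_ideal s"
  proof (induction s)
    case (Suc s)
    let ?n = "CARD('p) ^ s"
    have "fps_X * S 1 (CARD('p) ^ Suc s) = fps_X * (S 1 ?n * S ?n CARD('p))"
      using S[of 1 "CARD('p) ^ Suc s"] S[of ?n "CARD('p)"] S[of 1 ?n]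
      by (simp add: X mult.assoc[symmetric] mult.commute)
    then have split: "S 1 (CARD('p) ^ Suc s) = S 1 ?n * S ?n CARD('p)"
      by (simp del: power_Suc)
    have "S ?n CARD('p) \<in> base_ideal 1"
      by (simp add: base_ideal_1_iff S_def fps_sum_nth fps_nth_power_0 qvar_def del: One_nat_def)
    from base_ideal_mult[OF Suc this] show ?case by (simp only: split Suc_eq_plus1[symmetric])
  qed simp
  with eq show ?thesis by (intro that)
qed

lemma series_ideal_0 [simp]: "x \<in> series_ideal 0"
  by (simp add: series_ideal_def)

lemma series_ideal_zero [simp]: "0 \<in> series_ideal k"
  by (simp add: series_ideal_def)

lemma series_ideal_add: "x \<in> series_ideal k \<Longrightarrow> y \<in> series_ideal k \<Longrightarrow> x + y \<in> series_ideal k"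
  by (simp add: series_ideal_def base_ideal_add)

lemma series_ideal_diff: "x \<in> series_ideal k \<Longrightarrow> y \<in> series_ideal k \<Longrightarrow> x - y \<in> series_ideal k"
  by (simp add: series_ideal_def base_ideal_diff)

lemma series_ideal_minus_iff [simp]: "- x \<in> series_ideal k \<longleftrightarrow> x \<in> series_ideal k"
  using series_ideal_diff[of 0 k x] series_ideal_diff[of 0 k "- x"] by auto

lemma series_ideal_minus_commute: "x - y \<in> series_ideal k \<longleftrightarrow> y - x \<in> series_ideal k"
  using series_ideal_minus_iff[of "x - y" k] by simp

lemma series_ideal_trans:
  "x - y \<in> series_ideal k \<Longrightarrow> y - z \<in> series_ideal k \<Longrightarrow> x - z \<in> series_ideal k"
  using series_ideal_add[of "x - y" k "y - z"] by simp

lemma series_ideal_common: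
  "x - y \<in> series_ideal k \<Longrightarrow> x - z \<in> series_ideal k \<Longrightarrow> y - z \<in> series_ideal k"
  using series_ideal_diff[of "x - z" k "x - y"] by simp

lemma series_ideal_sum: "(\<And>i. i \<in> S \<Longrightarrow> f i \<in> series_ideal k) \<Longrightarrow> sum f S \<in> series_ideal k"
  by (induction S rule: infinite_finite_induct) (auto intro: series_ideal_add)

lemma series_ideal_mono: "l \<le> k \<Longrightarrow> x \<in> series_ideal k \<Longrightarrow> x \<in> series_ideal l"
  unfolding series_ideal_def mem_Collect_eq by (intro allI base_ideal_mono[of l k]) simp_all

lemma series_ideal_mult:
  "x \<in> series_ideal k \<Longrightarrow> y \<in> series_ideal l \<Longrightarrow> x * y \<in> series_ideal (k + l)"
  unfolding series_ideal_def mem_Collect_eq fps_mult_nth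
  by (intro allI base_ideal_sum base_ideal_mult) simp_all

lemma series_ideal_mult_left: "y \<in> series_ideal k \<Longrightarrow> x * y \<in> series_ideal k"
  using series_ideal_mult[of x 0 y k] by simp

lemma series_ideal_mult_right: "x \<in> series_ideal k \<Longrightarrow> x * y \<in> series_ideal k"
  using series_ideal_mult[of x k y 0] by simp

lemma series_ideal_power: "x \<in> series_ideal 1 \<Longrightarrow> x ^ n \<in> series_ideal n"
proof (induction n)
  case (Suc n)
  from series_ideal_mult[OF Suc.prems Suc.IH[OF Suc.prems]] show ?case by simp
qed simp

lemma series_ideal_const: "f \<in> base_ideal k \<Longrightarrow> fps_const f \<in> series_ideal k"
  by (simp add: series_ideal_def)

lemma series_ideal_of_nat_dvd:
  fixes x :: "'p::prime_card qring fps"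
  assumes "of_nat CARD('p) dvd x"
  shows "x \<in> series_ideal 1"
proof -
  have "(of_nat CARD('p) :: 'p qring) $ 0 = of_nat CARD('p)"
    by (simp only: fps_of_nat[symmetric] fps_nth_fps_const refl if_True)
  then have "(fps_const (of_nat CARD('p)) :: 'p qring fps) \<in> series_ideal 1"
    by (intro series_ideal_const) (simp only: base_ideal_1_iff dvd_refl)
  then have "(of_nat CARD('p) :: 'p qring fps) \<in> series_ideal 1" by (simp only: fps_of_nat)
  moreover obtain y where "x = of_nat CARD('p) * y" using assms ..
  ultimately show ?thesis by (simp only: series_ideal_mult_right)
qed

lemma series_ideal_iff:
  "x \<in> series_ideal k \<longleftrightarrow> (\<forall>j i. of_nat CARD('p) ^ (k - i) dvd x $ j $ i)"
  for x :: "'p::prime_card qring fps"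
  by (simp add: series_ideal_def base_ideal_def)

lemma series_ideal_separated:
  fixes x :: "'p::prime_card qring fps"
  assumes "\<And>n. x \<in> series_ideal n"
  shows "x = 0"
proof -
  have "x $ j $ i = 0" for i j
  proof (rule padic_separated)
    fix n
    show "of_nat CARD('p) ^ n dvd x $ j $ i"
      using assms[of "n + i"] unfolding series_ideal_iff by (metis add_diff_cancel_right')
  qed
  then show ?thesis by (simp add: fps_eq_iff)
qed

lemma series_complete:
  fixes a :: "nat \<Rightarrow> 'p::prime_card qring fps"
  assumes "\<And>n. a (Suc n) - a n \<in> series_ideal n"
  obtains x where "\<And>n. x - a n \<in> series_ideal n"
proof -
  have "\<exists>y. \<forall>n. of_nat CARD('p) ^ n dvd y - a (n + i) $ j $ i" for i j
  proof -
    have "of_nat CARD('p) ^ n dvd a (Suc n + i) $ j $ i - a (n + i) $ j $ i" for n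
    proof -
      have "of_nat CARD('p) ^ (n + i - i) dvd (a (Suc (n + i)) - a (n + i)) $ j $ i"
        using assms[of "n + i"] unfolding series_ideal_iff by blast
      then show ?thesis by simp
    qed
    then obtain y where "\<And>n. of_nat CARD('p) ^ n dvd y - a (n + i) $ j $ i"
      using padic_complete[of "\<lambda>n. a (n + i) $ j $ i"] by auto
    then show ?thesis by blast
  qed
  then obtain y where y: "of_nat CARD('p) ^ n dvd y i j - a (n + i) $ j $ i" for i j n
    by metis
  show ?thesis
  proof (rule that[of "Abs_fps (\<lambda>j. Abs_fps (\<lambda>i. y i j))"])
    fix n
    have "of_nat CARD('p) ^ (n - i) dvd y i j - a n $ j $ i" for i j
      using y[of "n - i" i j] by (cases "i \<le> n") auto
    then show "Abs_fps (\<lambda>j. Abs_fps (\<lambda>i. y i j)) - a n \<in> series_ideal n"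
      by (simp add: series_ideal_iff)
  qed
qed

lemma of_nat_power_qring_fps:
  "of_nat n ^ i = (fps_const (fps_const (of_nat n ^ i)) :: 'p::prime_card qring fps)"
  by (simp only: fps_of_nat fps_const_power[symmetric])

lemma pq_generator:
  "of_nat CARD('p) ^ i * fps_const (qvar - 1) ^ l
    = (fps_const (fps_const (of_nat CARD('p) ^ i) * fps_X ^ l) :: 'p::prime_card qring fps)"
proof -
  have "fps_const (qvar - 1) ^ l = (fps_const (fps_X ^ l) :: 'p qring fps)"
    by (simp only: qvar_def fps_const_power add_diff_cancel_left')
  then show ?thesis by (simp only: fps_const_mult of_nat_power_qring_fps)
qed

lemma pq_generator_in_base_ideal:
  "fps_const (of_nat CARD('p) ^ i) * fps_X ^ l \<in> (base_ideal (i + l) :: 'p::prime_card qring set)"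
  unfolding base_ideal_def by (simp add: fps_X_power_nth)

lemma pq_power_UNIV: "pq_power k UNIV = (series_ideal k :: 'p::prime_card qring fps set)"
proof (intro equalityI subsetI)
  fix x :: "'p qring fps"
  assume "x \<in> pq_power k UNIV"
  then obtain t where x: "x = (\<Sum>i\<le>k. of_nat CARD('p) ^ i * fps_const (qvar - 1) ^ (k - i) * t i)"
    unfolding pq_power_def by blast
  have "of_nat CARD('p) ^ i * fps_const (qvar - 1) ^ (k - i) * t i \<in> series_ideal k"
    if "i \<le> k" for i
    using series_ideal_const[OF pq_generator_in_base_ideal[of i "k - i", where 'p='p]] that
    unfolding pq_generator by (intro series_ideal_mult_right) simp
  then show "x \<in> series_ideal k"
    unfolding x by (intro series_ideal_sum) simp
next
  fix x :: "'p qring fps"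
  assume x: "x \<in> series_ideal k"
  have "\<forall>j i. \<exists>y. x $ j $ i = of_nat CARD('p) ^ (k - i) * y"
    using x unfolding series_ideal_iff dvd_def by blast
  then obtain y where y: "x $ j $ i = of_nat CARD('p) ^ (k - i) * y j i" for i j by metis
  \<comment> \<open>The generator \<open>(q-1)\<^sup>k\<close> absorbs all coefficients from the \<open>k\<close>-th on; the coefficient with index
      \<open>k - l\<close> below \<open>k\<close> is the only one assigned to \<open>p\<^sup>l (q-1)\<^bsup>k-l\<^esup>\<close>.\<close>
  define t where "t l = (if l = 0 then Abs_fps (\<lambda>j. Abs_fps (\<lambda>i. x $ j $ (k + i)))
      else Abs_fps (\<lambda>j. fps_const (y j (k - l))))" for l
  have "x = (\<Sum>l\<le>k. fps_const (fps_const (of_nat CARD('p) ^ l) * fps_X ^ (k - l)) * t l)"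
  proof (intro fps_ext)
    fix j i
    have "(\<Sum>l\<le>k. fps_const (fps_const (of_nat CARD('p) ^ l) * fps_X ^ (k - l)) * t l) $ j $ i
        = (\<Sum>l\<le>k. if l = k - i then x $ j $ i else 0)"
      unfolding fps_sum_nth
    proof (intro sum.cong refl)
      fix l assume l: "l \<in> {..k}"
      have "(fps_const (fps_const (of_nat CARD('p) ^ l) * fps_X ^ (k - l)) * t l) $ j $ i
          = of_nat CARD('p) ^ l * (if i < k - l then 0 else t l $ j $ (i - (k - l)))"
        by (simp only: fps_mult_left_const_nth mult.assoc fps_X_power_mult_nth)
      also have "\<dots> = (if l = k - i then x $ j $ i else 0)"
      proof (cases "l = 0")
        case True
        then show ?thesis by (simp add: t_def)
      next
        case False
        then show ?thesis using l y[of j i] by (auto simp: t_def)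
      qed
      finally show "(fps_const (fps_const (of_nat CARD('p) ^ l) * fps_X ^ (k - l)) * t l) $ j $ i
          = (if l = k - i then x $ j $ i else 0)" .
    qed
    also have "\<dots> = x $ j $ i" by simp
    finally show "x $ j $ i
        = (\<Sum>l\<le>k. fps_const (fps_const (of_nat CARD('p) ^ l) * fps_X ^ (k - l)) * t l) $ j $ i" by simp
  qed
  then show "x \<in> pq_power k UNIV"
    unfolding pq_power_def pq_generator by auto
qed

section \<open>Transfer operators and the Dwork congruence\<close>

text \<open>
  Continuity of a function on \<open>\<nat>\<close> for the p-adic topology, with a rate: \<open>e\<close> is the number of powers of
  \<open>I\<close> gained over the p-adic distance. For \<open>j = 0\<close> this says that \<open>h\<close> is constant modulo \<open>I\<^sup>e\<close>.
\<close>

definition adic_continuous :: "nat \<Rightarrow> (nat \<Rightarrow> 'p::prime_card qring fps) \<Rightarrow> bool" where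
  "adic_continuous e h \<longleftrightarrow> (\<forall>j n m. h (n + m * CARD('p) ^ j) - h n \<in> series_ideal (j + e))"

text \<open>
  The Ruelle transfer operator of the map \<open>n \<mapsto> n div p\<close> with weight \<open>\<alpha>\<close>: it sums over the preimages of
  \<open>m\<close>, that is, over all choices of a new lowest digit.
\<close>

definition transfer_op ::
  "(nat \<Rightarrow> 'p::prime_card qring fps) \<Rightarrow> (nat \<Rightarrow> 'p qring fps) \<Rightarrow> nat \<Rightarrow> 'p qring fps" where
  "transfer_op \<alpha> h m = (\<Sum>a<CARD('p). \<alpha> (a + CARD('p) * m) * h (a + CARD('p) * m))"

text \<open>
  Summing over \<open>s\<close> digits, lowest digit first, with the \<open>k\<close>-th weight used for the \<open>k\<close>-th digit.
\<close>

fun transfer_sum ::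
  "(nat \<Rightarrow> nat \<Rightarrow> 'p::prime_card qring fps) \<Rightarrow> nat \<Rightarrow> (nat \<Rightarrow> 'p qring fps) \<Rightarrow> 'p qring fps" where
  "transfer_sum \<alpha> 0 h = h 0"
| "transfer_sum \<alpha> (Suc s) h = transfer_sum (\<lambda>k. \<alpha> (Suc k)) s (transfer_op (\<alpha> 0) h)"

lemma adic_continuousD:
  "adic_continuous e h \<Longrightarrow> h (n + m * CARD('p) ^ j) - h n \<in> series_ideal (j + e)"
  for h :: "nat \<Rightarrow> 'p::prime_card qring fps"
  by (simp add: adic_continuous_def)

lemma adic_continuous_near_0: "adic_continuous e h \<Longrightarrow> h n - h 0 \<in> series_ideal e"
  using adic_continuousD[of e h 0 n 0] by simp

lemma adic_continuous_mono: "e' \<le> e \<Longrightarrow> adic_continuous e h \<Longrightarrow> adic_continuous e' h"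
  unfolding adic_continuous_def by (blast intro: series_ideal_mono[OF add_left_mono])

lemma adic_continuous_const [simp]: "adic_continuous e (\<lambda>_. c)"
  by (simp add: adic_continuous_def)

lemma adic_continuous_diff_mult:
  assumes "adic_continuous e h" "adic_continuous e' w" "c \<in> series_ideal (e - e')"
  shows "adic_continuous e (\<lambda>n. h n - c * w n)"
  unfolding adic_continuous_def
proof (intro allI)
  fix j n m
  have "(h (n + m * CARD('a) ^ j) - h n) - c * (w (n + m * CARD('a) ^ j) - w n) \<in> series_ideal (j + e)"
  proof (rule series_ideal_diff)
    have "c * (w (n + m * CARD('a) ^ j) - w n) \<in> series_ideal ((e - e') + (j + e'))"
      using assms by (intro series_ideal_mult adic_continuousD)
    then show "c * (w (n + m * CARD('a) ^ j) - w n) \<in> series_ideal (j + e)"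
      by (rule series_ideal_mono[rotated]) simp
  qed (use assms adic_continuousD in blast)
  then show "h (n + m * CARD('a) ^ j) - c * w (n + m * CARD('a) ^ j) - (h n - c * w n)
      \<in> series_ideal (j + e)"
    by (simp add: algebra_simps)
qed

text \<open>
  The gain: preimages of \<open>p\<^sup>j\<close>-close numbers with the same lowest digit are \<open>p\<^bsup>j+1\<^esup>\<close>-close. The weight
  itself is only continuous with rate \<open>0\<close>, which is made up for by the smallness of the values of \<open>h\<close>.
\<close>

lemma transfer_op_continuous:
  assumes \<alpha>: "adic_continuous 0 \<alpha>" and h: "adic_continuous e h" "\<And>n. h n \<in> series_ideal e"
  shows "adic_continuous (Suc e) (transfer_op \<alpha> h)"
  unfolding adic_continuous_def
proof (intro allI)
  fix j n m
  have near: "\<alpha> y * h y - \<alpha> x * h x \<in> series_ideal (j + Suc e)"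
    if xy: "y = x + CARD('a) * (m * CARD('a) ^ j)" for x y
  proof -
    have xy: "y = x + m * CARD('a) ^ Suc j" using xy by simp
    have "(\<alpha> y - \<alpha> x) * h y + \<alpha> x * (h y - h x) \<in> series_ideal (Suc j + e)"
    proof (rule series_ideal_add)
      show "(\<alpha> y - \<alpha> x) * h y \<in> series_ideal (Suc j + e)"
        using adic_continuousD[OF \<alpha>, of x m "Suc j"] h(2) unfolding xy by (intro series_ideal_mult) simp_all
      show "\<alpha> x * (h y - h x) \<in> series_ideal (Suc j + e)"
        using adic_continuousD[OF h(1), of x m "Suc j"] unfolding xy by (rule series_ideal_mult_left)
    qed
    then show ?thesis by (simp add: algebra_simps)
  qed
  show "transfer_op \<alpha> h (n + m * CARD('a) ^ j) - transfer_op \<alpha> h n \<in> series_ideal (j + Suc e)"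
    unfolding transfer_op_def sum_subtractf[symmetric]
    by (intro series_ideal_sum near) (simp only: distrib_left add.assoc)
qed

lemma transfer_op_diff_mult:
  "transfer_op \<alpha> (\<lambda>n. h n - c * w n) = (\<lambda>m. transfer_op \<alpha> h m - c * transfer_op \<alpha> w m)"
  by (simp add: transfer_op_def fun_eq_iff sum_subtractf sum_distrib_left algebra_simps)

lemma transfer_sum_diff_mult:
  "transfer_sum \<alpha> s (\<lambda>n. h n - c * w n) = transfer_sum \<alpha> s h - c * transfer_sum \<alpha> s w"
  by (induction s arbitrary: \<alpha> h w) (simp_all add: transfer_op_diff_mult)

lemma transfer_op_in_series_ideal:
  "(\<And>n. h n \<in> series_ideal e) \<Longrightarrow> transfer_op \<alpha> h m \<in> series_ideal e"
  unfolding transfer_op_def by (intro series_ideal_sum series_ideal_mult_left)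

lemma transfer_sum_in_series_ideal:
  "(\<And>n. h n \<in> series_ideal e) \<Longrightarrow> transfer_sum \<alpha> s h \<in> series_ideal e"
  by (induction s arbitrary: \<alpha> h) (simp_all add: transfer_op_in_series_ideal)

text \<open>
  Replacing \<open>h\<close> by its value at \<open>0\<close> changes it by elements of \<open>I\<^sup>e\<close> only. This gives
  \<open>F\<^bsub>s+1\<^esub> \<equiv> F\<^sub>1 \<phi>(F\<^sub>s)\<close> modulo \<open>I\<close>.
\<close>

lemma transfer_sum_near_const:
  assumes "adic_continuous e h"
  shows "transfer_sum \<alpha> s h - h 0 * transfer_sum \<alpha> s (\<lambda>_. 1) \<in> series_ideal e"
proof -
  have "transfer_sum \<alpha> s (\<lambda>n. h n - h 0 * 1) \<in> series_ideal e"
    using adic_continuous_near_0[OF assms] by (intro transfer_sum_in_series_ideal) simp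
  then show ?thesis by (simp only: transfer_sum_diff_mult)
qed

text \<open>
  The multiple is \<open>c = h(0)/w(0)\<close>. It lies in \<open>I\<^bsup>e-1\<^esup>\<close>, so subtracting \<open>c w\<close>, where \<open>w\<close> has rate \<open>1\<close>,
  preserves the rate \<open>e\<close>; a function of rate \<open>e\<close> that vanishes at \<open>0\<close> has values in \<open>I\<^sup>e\<close>.
\<close>

lemma subtract_multiple_vanishing_at_0:
  assumes h: "adic_continuous e h" "\<And>n. h n \<in> series_ideal (e - 1)"
    and w: "adic_continuous 1 w" "w 0 $ 0 = 1"
  obtains c where "h 0 - c * w 0 = 0" "adic_continuous e (\<lambda>n. h n - c * w n)"
    "\<And>n. h n - c * w n \<in> series_ideal e"
proof -
  obtain v where v: "w 0 * v = 1"
    using fps_right_inverse[of "w 0" 1] w(2) by auto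
  define c where "c = h 0 * v"
  have 0: "h 0 - c * w 0 = 0" unfolding c_def using v by (simp add: mult_ac)
  have cont: "adic_continuous e (\<lambda>n. h n - c * w n)"
    using h w unfolding c_def by (intro adic_continuous_diff_mult series_ideal_mult_right)
  have "h n - c * w n \<in> series_ideal e" for n
    using adic_continuous_near_0[OF cont, of n] 0 by simp
  with 0 cont show ?thesis by (rule that)
qed

text \<open>
  The heart of the proof: the quotients of the transfer sums of \<open>h\<close> and of \<open>w\<close> form a Cauchy sequence,
  stated without denominators. The left-hand side is bilinear and alternating in \<open>(h, w)\<close>, hence
  unchanged when a multiple of \<open>w\<close> is subtracted from \<open>h\<close>. So \<open>h\<close> may be assumed to have values in
  \<open>I\<^sup>e\<close>. One application of the transfer operator then raises the rate of \<open>h\<close> to \<open>e + 1\<close> while keeping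
  that of \<open>w\<close> at \<open>1\<close>, and reduces the number of digits by one. The condition on \<open>\<alpha>\<close> at \<open>\<lambda> = 0\<close> keeps
  the value of \<open>w\<close> at \<open>0\<close> invertible.
\<close>

lemma transfer_sum_contraction:
  fixes \<alpha> :: "nat \<Rightarrow> nat \<Rightarrow> 'p::prime_card qring fps"
  assumes "\<And>k. adic_continuous 0 (\<alpha> k)"
    and "\<And>k a. a < CARD('p) \<Longrightarrow> \<alpha> k a $ 0 = (if a = 0 then 1 else 0)"
    and "adic_continuous e h" "\<And>n. h n \<in> series_ideal (e - 1)"
    and "adic_continuous 1 w" "w 0 $ 0 = 1"
  shows "transfer_sum \<alpha> (Suc s) h * transfer_sum \<alpha> s w - transfer_sum \<alpha> s h * transfer_sum \<alpha> (Suc s) w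
    \<in> series_ideal (s + e)"
  using assms
proof (induction s arbitrary: \<alpha> e h w)
  case (0 \<alpha> e h w)
  obtain c where c: "h 0 - c * w 0 = 0" "\<And>n. h n - c * w n \<in> series_ideal e"
    using subtract_multiple_vanishing_at_0[OF "0.prems"(3-6)] by blast
  have "transfer_op (\<alpha> 0) (\<lambda>n. h n - c * w n) 0 * w 0 - (h 0 - c * w 0) * transfer_op (\<alpha> 0) w 0
      \<in> series_ideal e"
    using transfer_op_in_series_ideal[of "\<lambda>n. h n - c * w n" e, OF c(2)]
    unfolding c(1) by (auto intro: series_ideal_mult_right)
  then show ?case
    unfolding transfer_op_diff_mult by (simp add: algebra_simps)
next
  case (Suc s \<alpha> e h w)
  obtain c where c: "adic_continuous e (\<lambda>n. h n - c * w n)" "\<And>n. h n - c * w n \<in> series_ideal e"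
    using subtract_multiple_vanishing_at_0[OF Suc.prems(3-6)] by blast
  let ?h = "transfer_op (\<alpha> 0) (\<lambda>n. h n - c * w n)" and ?w = "transfer_op (\<alpha> 0) w"
  let ?L = "transfer_sum (\<lambda>k. \<alpha> (Suc k))"
  have w0: "?w 0 $ 0 = 1"
  proof -
    have "?w 0 $ 0 = (\<Sum>a<CARD('p). \<alpha> 0 a $ 0 * w a $ 0)"
      by (simp add: transfer_op_def fps_sum_nth)
    also have "\<dots> = (\<Sum>a<CARD('p). if a = 0 then 1 else 0)"
      using Suc.prems(2,6) by (intro sum.cong) auto
    finally have "?w 0 $ 0 = (\<Sum>a<CARD('p). if a = 0 then 1 else 0)" .
    then show ?thesis by (simp add: prime_gt_0_nat prime_card)
  qed
  have "?L (Suc s) ?h * ?L s ?w - ?L s ?h * ?L (Suc s) ?w \<in> series_ideal (s + Suc e)"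
  proof (rule Suc.IH)
    show "adic_continuous (Suc e) ?h"
      using Suc.prems(1) c by (rule transfer_op_continuous)
    show "?h n \<in> series_ideal (Suc e - 1)" for n
      using c(2) by (simp add: transfer_op_in_series_ideal)
    show "adic_continuous 1 ?w"
      using transfer_op_continuous[OF Suc.prems(1), of 0 w] adic_continuous_mono[OF _ Suc.prems(5)]
      by simp
  qed (use Suc.prems w0 in auto)
  then show ?case
    unfolding transfer_op_diff_mult transfer_sum_diff_mult by (simp add: algebra_simps)
qed

section \<open>The completed localization as a closed subring\<close>

lemma localized_poly: "fps_of_poly h \<in> localized g"
proof -
  have "fps_of_poly h * fps_of_poly g ^ 0 = fps_of_poly h" by simp
  then show ?thesis unfolding localized_def by blast
qed

lemma localized_add: "x \<in> localized g \<Longrightarrow> y \<in> localized g \<Longrightarrow> x + y \<in> localized g"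
proof -
  assume "x \<in> localized g" "y \<in> localized g"
  then obtain h k h' k' where
    hk: "x * fps_of_poly g ^ k = fps_of_poly h" "y * fps_of_poly g ^ k' = fps_of_poly h'"
    unfolding localized_def by blast
  from this[symmetric] have "(x + y) * fps_of_poly g ^ (k + k') = fps_of_poly (h * g ^ k' + h' * g ^ k)"
    by (simp add: fps_of_poly_add fps_of_poly_mult fps_of_poly_power power_add algebra_simps)
  then show ?thesis unfolding localized_def by blast
qed

lemma localized_mult: "x \<in> localized g \<Longrightarrow> y \<in> localized g \<Longrightarrow> x * y \<in> localized g"
proof -
  assume "x \<in> localized g" "y \<in> localized g"
  then obtain h k h' k' where
    hk: "x * fps_of_poly g ^ k = fps_of_poly h" "y * fps_of_poly g ^ k' = fps_of_poly h'"
    unfolding localized_def by blast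
  from this[symmetric] have "(x * y) * fps_of_poly g ^ (k + k') = fps_of_poly (h * h')"
    by (simp add: fps_of_poly_mult power_add mult_ac)
  then show ?thesis unfolding localized_def by blast
qed

lemma localized_const: "fps_const c \<in> localized g"
  using localized_poly[of "[:c:]" g] by (simp add: fps_of_poly_const)

lemma localized_diff: "x \<in> localized g \<Longrightarrow> y \<in> localized g \<Longrightarrow> x - y \<in> localized g"
proof -
  assume "x \<in> localized g" "y \<in> localized g"
  then have "x + fps_const (-1) * y \<in> localized g" by (intro localized_add localized_mult localized_const)
  then show ?thesis by (simp add: fps_const_neg[symmetric] del: fps_const_neg)
qed

lemma localized_sum: "(\<And>i. i \<in> S \<Longrightarrow> f i \<in> localized g) \<Longrightarrow> sum f S \<in> localized g"
  using localized_poly[of 0 g]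
  by (induction S rule: infinite_finite_induct) (auto intro: localized_add)

text \<open>
  \<open>T\<close> is the closure of the localization in \<open>R[[\<lambda>]]\<close>: the compatibility of an approximating sequence
  inside the localization is automatic, because the latter carries the induced topology.
\<close>

lemma completed_iff:
  fixes g :: "'p::prime_card qring poly"
  assumes g: "poly.coeff g 0 dvd 1"
  shows "x \<in> completed g \<longleftrightarrow> (\<forall>n. \<exists>a\<in>localized g. x - a \<in> series_ideal n)"
proof
  assume "x \<in> completed g"
  then show "\<forall>n. \<exists>a\<in>localized g. x - a \<in> series_ideal n"
    unfolding completed_def pq_power_UNIV by blast
next
  assume "\<forall>n. \<exists>a\<in>localized g. x - a \<in> series_ideal n"
  then have "\<forall>n. \<exists>a. a \<in> localized g \<and> x - a \<in> series_ideal n" by blast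
  from choice[OF this] obtain a where
    a: "\<And>n. a n \<in> localized g" "\<And>n. x - a n \<in> series_ideal n" by blast
  have "a (Suc n) - a n \<in> pq_power n (localized g)" for n
  proof -
    have "x - a (Suc n) \<in> series_ideal n" using a(2)[of "Suc n"] by (rule series_ideal_mono[rotated]) simp
    then have "a (Suc n) - a n \<in> series_ideal n"
      using a(2)[of n] by (rule series_ideal_common)
    then show ?thesis
      using localized_pq_power[OF g localized_diff[OF a(1) a(1)]] by (simp add: pq_power_UNIV)
  qed
  then show "x \<in> completed g"
    unfolding completed_def pq_power_UNIV by (intro CollectI exI[of _ a] allI conjI a)
qed

context
  fixes g :: "'p::prime_card qring poly"
  assumes g: "poly.coeff g 0 dvd 1"
begin

lemma completed_localized: "x \<in> localized g \<Longrightarrow> x \<in> completed g"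
  unfolding completed_iff[OF g] by (intro allI bexI[of _ x]) simp_all

lemma completed_approx: "x \<in> completed g \<Longrightarrow> \<exists>a\<in>localized g. x - a \<in> series_ideal n"
  unfolding completed_iff[OF g] by blast

lemma completed_closed:
  assumes "\<And>n. \<exists>y\<in>completed g. x - y \<in> series_ideal n"
  shows "x \<in> completed g"
  unfolding completed_iff[OF g]
proof
  fix n
  obtain y where y: "y \<in> completed g" "x - y \<in> series_ideal n" using assms[of n] ..
  obtain a where "a \<in> localized g" "y - a \<in> series_ideal n"
    using completed_approx[OF y(1), of n] ..
  with series_ideal_trans[OF y(2)] show "\<exists>a\<in>localized g. x - a \<in> series_ideal n"
    by (intro bexI[of _ a])
qed

lemma completed_add:
  assumes "x \<in> completed g" "y \<in> completed g"
  shows "x + y \<in> completed g"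
  unfolding completed_iff[OF g]
proof
  fix n
  obtain a b where "a \<in> localized g" "x - a \<in> series_ideal n" "b \<in> localized g" "y - b \<in> series_ideal n"
    using completed_approx[OF assms(1), of n] completed_approx[OF assms(2), of n] by (elim bexE)
  then show "\<exists>a\<in>localized g. x + y - a \<in> series_ideal n"
    using series_ideal_add[of "x - a" n "y - b"]
    by (intro bexI[of _ "a + b"] localized_add) (simp_all add: algebra_simps)
qed

lemma completed_mult:
  assumes "x \<in> completed g" "y \<in> completed g"
  shows "x * y \<in> completed g"
  unfolding completed_iff[OF g]
proof
  fix n
  obtain a b where ab: "a \<in> localized g" "x - a \<in> series_ideal n" "b \<in> localized g" "y - b \<in> series_ideal n"
    using completed_approx[OF assms(1), of n] completed_approx[OF assms(2), of n] by (elim bexE)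
  have "x * (y - b) + b * (x - a) \<in> series_ideal n"
    using ab by (intro series_ideal_add series_ideal_mult_left)
  then have "x * y - a * b \<in> series_ideal n" by (simp add: algebra_simps)
  then show "\<exists>a\<in>localized g. x * y - a \<in> series_ideal n"
    using ab localized_mult by blast
qed

lemma completed_1: "1 \<in> completed g"
  using completed_localized[OF localized_const[of 1]] by simp

lemma completed_diff: "x \<in> completed g \<Longrightarrow> y \<in> completed g \<Longrightarrow> x - y \<in> completed g"
proof -
  assume "x \<in> completed g" "y \<in> completed g"
  then have "x + fps_const (-1) * y \<in> completed g"
    by (intro completed_add completed_mult completed_localized[OF localized_const])
  then show ?thesis by (simp add: fps_const_neg[symmetric] del: fps_const_neg)
qed

lemma completed_sum: "(\<And>i. i \<in> S \<Longrightarrow> f i \<in> completed g) \<Longrightarrow> sum f S \<in> completed g"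
  using completed_localized[OF localized_poly[of 0]]
  by (induction S rule: infinite_finite_induct) (auto intro: completed_add)

lemma completed_power: "x \<in> completed g \<Longrightarrow> x ^ n \<in> completed g"
  by (induction n) (auto intro: completed_mult completed_1)

text \<open>
  \<open>I\<^bsup>k+n\<^esup> = I\<^sup>k I\<^sup>n\<close> with the standard generators of \<open>I\<^sup>k\<close>: the generators of \<open>I\<^bsup>k+n\<^esup>\<close> with fewer than \<open>k\<close>
  factors \<open>p\<close> are divided by \<open>(q-1)\<^sup>n\<close>, the other ones by \<open>p\<^sup>k\<close>.
\<close>

lemma localized_series_ideal_split:
  assumes "y \<in> localized g" "y \<in> series_ideal (k + n)"
  obtains t where "y = (\<Sum>i\<le>k. of_nat CARD('p) ^ i * fps_const (qvar - 1) ^ (k - i) * t i)"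
    "\<And>i. t i \<in> localized g" "\<And>i. t i \<in> series_ideal n"
proof -
  define c :: "nat \<Rightarrow> nat \<Rightarrow> 'p qring fps"
    where "c i l = of_nat CARD('p) ^ i * fps_const (qvar - 1) ^ l" for i l
  have c_loc: "c i l \<in> localized g" for i l
    unfolding c_def pq_generator by (rule localized_const)
  have c_ideal: "c i l \<in> series_ideal (i + l)" for i l
    unfolding c_def pq_generator by (intro series_ideal_const pq_generator_in_base_ideal)
  have c_mult: "c i l * c i' l' = c (i + i') (l + l')" for i l i' l'
    by (simp add: c_def power_add mult_ac)
  have "y \<in> pq_power (k + n) (localized g)"
    using localized_pq_power[OF g assms(1), of "k + n"] assms(2) by (simp add: pq_power_UNIV)
  then obtain r where r: "\<And>i. r i \<in> localized g" "y = (\<Sum>i\<le>k + n. c i (k + n - i) * r i)"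
    unfolding pq_power_def c_def[symmetric] by blast
  define t where "t i = (if i < k then c 0 n * r i else \<Sum>l\<le>n. c l (n - l) * r (k + l))" for i
  have "y = (\<Sum>i<k. c i (k + n - i) * r i) + (\<Sum>l\<le>n. c (k + l) (k + n - (k + l)) * r (k + l))"
  proof -
    have "{..k + n} = {..<k} \<union> {k..k + n}" "{..<k} \<inter> {k..k + n} = {}" by auto
    then have "y = (\<Sum>i<k. c i (k + n - i) * r i) + (\<Sum>i=k..k + n. c i (k + n - i) * r i)"
      unfolding r(2) by (simp only: sum.union_disjoint[OF finite_lessThan finite_atLeastAtMost])
    also have "(\<Sum>i=k..k + n. c i (k + n - i) * r i)
        = (\<Sum>l\<le>n. c (k + l) (k + n - (k + l)) * r (k + l))"
      by (rule sum.reindex_bij_witness[of _ "\<lambda>l. k + l" "\<lambda>i. i - k"]) auto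
    finally show ?thesis .
  qed
  also have "(\<Sum>i<k. c i (k + n - i) * r i) = (\<Sum>i<k. c i (k - i) * t i)"
    by (intro sum.cong) (simp_all add: t_def mult.assoc[symmetric] c_mult)
  also have "(\<Sum>l\<le>n. c (k + l) (k + n - (k + l)) * r (k + l)) = c k (k - k) * t k"
    by (simp add: t_def sum_distrib_left mult.assoc[symmetric] c_mult)
  finally have "y = (\<Sum>i\<le>k. c i (k - i) * t i)"
    by (simp only: lessThan_Suc_atMost[symmetric] sum.lessThan_Suc)
  moreover have "t i \<in> localized g" for i
    by (cases "i < k") (simp_all add: t_def localized_mult localized_sum c_loc r)
  moreover have "t i \<in> series_ideal n" for i
  proof -
    have "c l (n - l) * r (k + l) \<in> series_ideal n" if "l \<le> n" for l
      using c_ideal[of l "n - l"] that by (simp add: series_ideal_mult_right)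
    moreover have "c 0 n * r i \<in> series_ideal n"
      using c_ideal[of 0 n] by (simp add: series_ideal_mult_right)
    ultimately show ?thesis unfolding t_def by (auto intro!: series_ideal_sum)
  qed
  ultimately show ?thesis unfolding c_def by (rule that)
qed

text \<open>
  So the topology of \<open>T\<close> is induced from \<open>R[[\<lambda>]]\<close>, and all congruences may be checked there. An
  element of \<open>T \<inter> I\<^sup>k\<close> is the sum of a convergent series with terms in \<open>I\<^bsup>k+n\<^esup>\<close> of the localization;
  the coefficients of these terms at each generator of \<open>I\<^sup>k\<close> form convergent series themselves,
  whose sums lie in \<open>T\<close>.
\<close>

lemma completed_inter_series_ideal:
  assumes x: "x \<in> completed g" "x \<in> series_ideal k"
  shows "x \<in> pq_power k (completed g)"
proof -
  have "\<forall>n. \<exists>a. a \<in> localized g \<and> x - a \<in> series_ideal (k + n)"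
    using completed_approx[OF x(1)] by blast
  from choice[OF this] obtain a where
    a: "\<And>n. a n \<in> localized g" "\<And>n. x - a n \<in> series_ideal (k + n)" by blast
  let ?c = "\<lambda>i. of_nat CARD('p) ^ i * fps_const (qvar - 1) ^ (k - i) :: 'p qring fps"
  have "a (Suc n) - a n \<in> series_ideal (k + n)" for n
  proof -
    have "x - a (Suc n) \<in> series_ideal (k + n)"
      using a(2)[of "Suc n"] by (rule series_ideal_mono[rotated]) simp
    then show ?thesis using a(2)[of n] by (rule series_ideal_common)
  qed
  then have "\<exists>t. a (Suc n) - a n = (\<Sum>i\<le>k. ?c i * t i)
      \<and> (\<forall>i. t i \<in> localized g \<and> t i \<in> series_ideal n)" for n
    by (rule localized_series_ideal_split[OF localized_diff[OF a(1) a(1)]]) blast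
  then have "\<forall>n. \<exists>t. a (Suc n) - a n = (\<Sum>i\<le>k. ?c i * t i)
      \<and> (\<forall>i. t i \<in> localized g \<and> t i \<in> series_ideal n)" by blast
  from choice[OF this] obtain t where t: "\<And>n. a (Suc n) - a n = (\<Sum>i\<le>k. ?c i * t n i)"
      "\<And>n i. t n i \<in> localized g" "\<And>n i. t n i \<in> series_ideal n"
    by blast
  have "x - a 0 \<in> series_ideal k" using a(2)[of 0] by simp
  from series_ideal_diff[OF x(2) this] have "a 0 \<in> series_ideal (k + 0)" by simp
  then obtain r where r: "a 0 = (\<Sum>i\<le>k. ?c i * r i)" "\<And>i. r i \<in> localized g"
    by (rule localized_series_ideal_split[OF a(1)]) blast
  define S where "S i n = r i + (\<Sum>m<n. t m i)" for i n
  have S_loc: "S i n \<in> localized g" for i n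
    unfolding S_def by (intro localized_add localized_sum r t)
  have "\<exists>y. \<forall>n. y - S i n \<in> series_ideal n" for i
  proof -
    have "S i (Suc n) - S i n \<in> series_ideal n" for n using t(3) by (simp add: S_def)
    then show ?thesis using series_complete[of "S i"] by blast
  qed
  then have "\<forall>i. \<exists>y. \<forall>n. y - S i n \<in> series_ideal n" by blast
  from choice[OF this] obtain y where y: "\<And>i n. y i - S i n \<in> series_ideal n" by blast
  have aS: "a n = (\<Sum>i\<le>k. ?c i * S i n)" for n
  proof (induction n)
    case (Suc n)
    have "a (Suc n) = a n + (\<Sum>i\<le>k. ?c i * t n i)" by (simp only: t(1)[symmetric] add_diff_eq add_diff_cancel_left')
    also have "\<dots> = (\<Sum>i\<le>k. ?c i * (S i n + t n i))"
      by (simp only: Suc sum.distrib[symmetric] distrib_left)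
    finally show ?case by (simp only: S_def sum.lessThan_Suc add.assoc)
  qed (simp only: S_def r(1) lessThan_0 sum.empty add_0_right)
  have "x - (\<Sum>i\<le>k. ?c i * y i) = 0"
  proof (rule series_ideal_separated)
    fix n
    have "a n - (\<Sum>i\<le>k. ?c i * y i) \<in> series_ideal n"
      unfolding aS sum_subtractf[symmetric] right_diff_distrib[symmetric]
      by (intro series_ideal_sum series_ideal_mult_left)
        (simp only: series_ideal_minus_commute[of "S _ n"] y)
    moreover have "x - a n \<in> series_ideal n"
      using a(2)[of n] by (rule series_ideal_mono[rotated]) simp
    ultimately show "x - (\<Sum>i\<le>k. ?c i * y i) \<in> series_ideal n" by (rule series_ideal_trans[rotated])
  qed
  moreover have "y i \<in> completed g" for i
  proof (rule completed_closed)
    show "\<exists>z\<in>completed g. y i - z \<in> series_ideal n" for n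
      using y completed_localized[OF S_loc] by (rule bexI)
  qed
  ultimately show ?thesis unfolding pq_power_def by (intro CollectI exI[of _ y]) simp
qed

text \<open>
  With \<open>v\<close> the inverse of \<open>w\<close>, the geometric series for \<open>x v = 1 - z\<close>, \<open>z \<in> I\<close>, converges in \<open>T\<close>,
  and \<open>v\<close> times its sum inverts \<open>x\<close>.
\<close>

lemma units_of_completed_lift:
  assumes w: "w \<in> units_of_subring (completed g)" and x: "x \<in> completed g" "x - w \<in> series_ideal 1"
  shows "x \<in> units_of_subring (completed g)"
proof -
  obtain v where v: "v \<in> completed g" "w * v = 1"
    using w unfolding units_of_subring_def by blast
  define z where "z = 1 - x * v"
  have "z = - ((x - w) * v)" using v by (simp add: z_def algebra_simps)
  then have "z \<in> series_ideal 1" using x by (simp only: series_ideal_minus_iff series_ideal_mult_right)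
  then have zn: "z ^ n \<in> series_ideal n" for n by (rule series_ideal_power)
  have zT: "z \<in> completed g" unfolding z_def by (intro completed_diff completed_mult completed_1 x v)
  define a where "a n = v * (\<Sum>i<n. z ^ i)" for n
  have "a (Suc n) - a n \<in> series_ideal n" for n
    using series_ideal_mult_left[OF zn] by (simp add: a_def algebra_simps)
  then obtain y where y: "\<And>n. y - a n \<in> series_ideal n" using series_complete by blast
  have "x * y - 1 = 0"
  proof (rule series_ideal_separated)
    fix n
    have "x * a n = (1 - z) * (\<Sum>i<n. z ^ i)" by (simp add: a_def z_def mult.assoc)
    also have "\<dots> = 1 - z ^ n" by (simp add: one_diff_power_eq)
    finally have "x * y - 1 = x * (y - a n) - z ^ n" by (simp add: algebra_simps)
    then show "x * y - 1 \<in> series_ideal n"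
      using y zn by (simp add: series_ideal_diff series_ideal_mult_left)
  qed
  moreover have "y \<in> completed g"
  proof (rule completed_closed)
    have "a n \<in> completed g" for n
      unfolding a_def by (intro completed_mult completed_sum completed_power v zT)
    with y show "\<exists>z\<in>completed g. y - z \<in> series_ideal n" for n by (rule bexI)
  qed
  ultimately show ?thesis using x(1) unfolding units_of_subring_def by auto
qed

end

section \<open>The truncated series as transfer sums\<close>

lemma phi_funpow_mult: "(phi ^^ k) (f * g) = (phi ^^ k) f * (phi ^^ k) g"
  by (induction k) (simp_all add: phi_mult)

lemma phi_funpow_diff: "(phi ^^ k) (f - g) = (phi ^^ k) f - (phi ^^ k) g"
  by (induction k) (simp_all add: phi_diff)

lemma phi_funpow_1: "(phi ^^ k) 1 = 1"
  by (induction k) simp_all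

lemma phi_funpow_base_ideal: "f \<in> base_ideal n \<Longrightarrow> (phi ^^ k) f \<in> base_ideal n"
  by (induction k) (simp_all add: phi_base_ideal)

text \<open>
  The weight of the \<open>k\<close>-th digit is \<open>\<phi>\<^sup>k\<close> applied to \<open>A(n) \<lambda>\<^sup>d\<close>, where \<open>d\<close> is the lowest digit of \<open>n\<close>, the
  number left after the first \<open>k\<close> digits have been removed.
\<close>

definition digit_weight :: "(nat \<Rightarrow> 'p::prime_card qring) \<Rightarrow> nat \<Rightarrow> nat \<Rightarrow> 'p qring fps" where
  "digit_weight A k n = fps_const ((phi ^^ k) (A n)) * fps_X ^ (CARD('p) ^ k * (n mod CARD('p)))"

lemma digit_weight_continuous:
  fixes A :: "nat \<Rightarrow> 'p::prime_card qring"
  assumes A: "\<And>n m j. A (n + m * CARD('p) ^ Suc j) - A n \<in> base_ideal (Suc j)"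
  shows "adic_continuous 0 (digit_weight A k)"
  unfolding adic_continuous_def
proof (intro allI)
  fix j n m
  show "digit_weight A k (n + m * CARD('p) ^ j) - digit_weight A k n \<in> series_ideal (j + 0)"
  proof (cases j)
    case (Suc i)
    let ?n = "n + m * CARD('p) ^ Suc i"
    have "?n mod CARD('p) = n mod CARD('p)"
      by (simp add: mult.left_commute[of m])
    then have "digit_weight A k ?n - digit_weight A k n
        = fps_const ((phi ^^ k) (A ?n - A n)) * fps_X ^ (CARD('p) ^ k * (n mod CARD('p)))"
      by (simp only: digit_weight_def phi_funpow_diff fps_const_sub[symmetric] left_diff_distrib)
    also have "\<dots> \<in> series_ideal (Suc i)"
      by (intro series_ideal_mult_right series_ideal_const phi_funpow_base_ideal A)
    finally show ?thesis using Suc by simp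
  qed simp
qed

lemma digit_weight_nth_0:
  fixes A :: "nat \<Rightarrow> 'p::prime_card qring"
  assumes "A 0 = 1" "a < CARD('p)"
  shows "digit_weight A k a $ 0 = (if a = 0 then 1 else 0)"
  using assms by (simp add: digit_weight_def phi_funpow_1 fps_X_power_nth)

lemma sum_blocks:
  fixes f :: "nat \<Rightarrow> 'a::comm_monoid_add"
  shows "(\<Sum>m<M. \<Sum>a<k. f (a + k * m)) = (\<Sum>n<k * M. f n)"
proof -
  have "(\<Sum>a<k. f (a + k * m)) = sum f {m * k..<m * k + k}" for m
    by (rule sum.reindex_bij_witness[of _ "\<lambda>n. n - m * k" "\<lambda>a. a + k * m"]) (auto simp: mult.commute)
  then show ?thesis by (simp add: sum.nat_group mult.commute)
qed

text \<open>
  Unfolding the recursion for \<open>B\<close> gives \<open>B(n) = A(n) \<phi>(A(n div p)) \<phi>\<^sup>2(A(n div p\<^sup>2)) \<dots>\<close>, while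
  \<open>\<lambda>\<^sup>n\<close> is the product over the digits. For \<open>i = 0\<close> and \<open>i = 1\<close> with \<open>h = 1\<close> the right-hand side is
  \<open>F\<^sub>s\<close> and \<open>\<phi>(F\<^sub>s)\<close>.
\<close>

lemma transfer_sum_digit_weight:
  fixes A B :: "nat \<Rightarrow> 'p::prime_card qring"
  assumes B: "\<And>n. B n = A n * phi (B (n div CARD('p)))" and B0: "B 0 = 1"
  shows "transfer_sum (\<lambda>k. digit_weight A (k + i)) s h
    = (\<Sum>n<CARD('p) ^ s. fps_const ((phi ^^ i) (B n)) * fps_X ^ (CARD('p) ^ i * n) * h n)"
proof (induction s arbitrary: i h)
  case 0
  show ?case by (simp add: B0 phi_funpow_1)
next
  case (Suc s)
  let ?p = "CARD('p)"
  have p: "0 < ?p" by (simp add: prime_gt_0_nat prime_card)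
  have "transfer_sum (\<lambda>k. digit_weight A (k + i)) (Suc s) h
      = transfer_sum (\<lambda>k. digit_weight A (k + Suc i)) s (transfer_op (digit_weight A i) h)"
    by simp
  also have "\<dots> = (\<Sum>m<?p ^ s. \<Sum>a<?p. fps_const ((phi ^^ i) (B (a + ?p * m)))
      * fps_X ^ (?p ^ i * (a + ?p * m)) * h (a + ?p * m))"
    unfolding Suc.IH transfer_op_def sum_distrib_left
  proof (intro sum.cong refl)
    fix m a assume "a \<in> {..<?p}"
    then have digits: "(a + ?p * m) div ?p = m" "(a + ?p * m) mod ?p = a" by auto
    have "(phi ^^ i) (B (a + ?p * m)) = (phi ^^ i) (A (a + ?p * m)) * (phi ^^ Suc i) (B m)"
      by (subst B) (simp only: digits phi_funpow_mult funpow_Suc_right o_apply)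
    then show "fps_const ((phi ^^ Suc i) (B m)) * fps_X ^ (?p ^ Suc i * m)
          * (digit_weight A i (a + ?p * m) * h (a + ?p * m))
        = fps_const ((phi ^^ i) (B (a + ?p * m))) * fps_X ^ (?p ^ i * (a + ?p * m)) * h (a + ?p * m)"
      unfolding digit_weight_def digits
      by (simp only: fps_const_mult[symmetric] distrib_left power_add power_Suc mult_ac)
  qed
  also have "\<dots> = (\<Sum>n<?p ^ Suc s. fps_const ((phi ^^ i) (B n)) * fps_X ^ (?p ^ i * n) * h n)"
    unfolding power_Suc[of ?p s]
    by (rule sum_blocks[of "\<lambda>n. fps_const ((phi ^^ i) (B n)) * fps_X ^ (?p ^ i * n) * h n"])
  finally show ?case .
qed

lemma fps_of_poly_trunc_series:
  "fps_of_poly (trunc_series B s) = (\<Sum>n<CARD('p) ^ s. fps_const (B n) * fps_X ^ n)"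
  for B :: "nat \<Rightarrow> 'p::prime_card qring"
  by (simp add: trunc_series_def fps_of_poly_sum fps_of_poly_monom)

lemma phi_lambda_trunc_series:
  fixes B :: "nat \<Rightarrow> 'p::prime_card qring"
  shows "phi_lambda (fps_of_poly (trunc_series B s))
    = (\<Sum>n<CARD('p) ^ s. fps_const (phi (B n)) * fps_X ^ (CARD('p) * n))"
proof -
  have p: "(fps_X ^ CARD('p) :: 'p qring fps) $ 0 = 0"
    by (simp add: fps_nth_power_0 zero_power prime_gt_0_nat prime_card)
  have "Abs_fps (\<lambda>i. phi (fps_of_poly (trunc_series B s) $ i))
      = (\<Sum>n<CARD('p) ^ s. fps_const (phi (B n)) * fps_X ^ n)"
  proof (rule fps_ext)
    fix i
    have delta: "(\<Sum>n<CARD('p) ^ s. C n * (if i = n then 1 else 0)) = (if i < CARD('p) ^ s then C i else 0)"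
      for C :: "nat \<Rightarrow> 'p qring"
      by (simp add: mult_delta_right)
    show "Abs_fps (\<lambda>i. phi (fps_of_poly (trunc_series B s) $ i)) $ i
        = (\<Sum>n<CARD('p) ^ s. fps_const (phi (B n)) * fps_X ^ n) $ i"
      by (simp add: fps_of_poly_trunc_series fps_sum_nth fps_X_power_nth delta del: of_nat_power)
  qed
  then show ?thesis
    by (simp add: phi_lambda_def fps_compose_sum_distrib fps_compose_mult_distrib[OF p]
        fps_compose_power[OF p, symmetric] fps_X_fps_compose_startby0[OF p] power_mult)
qed

text \<open>
  Modulo \<open>p\<close>, the \<open>p\<close>-th power of a sum of monomials is the sum of their \<open>p\<close>-th powers, which agree
  with the images of the monomials up to \<open>\<phi>(B(n)) \<equiv> B(n)\<^sup>p\<close>.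
\<close>

lemma phi_lambda_trunc_series_cong_power:
  fixes B :: "nat \<Rightarrow> 'p::prime_card qring" and s :: nat
  defines "F \<equiv> fps_of_poly (trunc_series B s)"
  shows "phi_lambda F - F ^ CARD('p) \<in> series_ideal 1"
proof -
  let ?p = "CARD('p)"
  define G where "G = (\<Sum>n<?p ^ s. (fps_const (B n) * fps_X ^ n) ^ ?p)"
  have "F ^ ?p - G \<in> series_ideal 1"
    unfolding F_def G_def fps_of_poly_trunc_series
    by (intro series_ideal_of_nat_dvd prime_dvd_power_sum prime_card)
  moreover have "phi_lambda F - G
      = (\<Sum>n<?p ^ s. fps_const (phi (B n) - B n ^ ?p) * fps_X ^ (?p * n))"
    unfolding F_def G_def phi_lambda_trunc_series sum_subtractf[symmetric]
    by (intro sum.cong refl) (simp only: power_mult_distrib power_mult[symmetric] mult.commute[of _ ?p]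
        fps_const_power fps_const_sub[symmetric] left_diff_distrib)
  then have "phi_lambda F - G \<in> series_ideal 1"
    by (simp only:) (intro series_ideal_sum series_ideal_mult_right series_ideal_const
        phi_minus_power_in_base_ideal)
  ultimately show ?thesis
    using series_ideal_trans series_ideal_minus_commute[of "F ^ ?p" G 1] by blast
qed

lemma phi_lambda_trunc_series_localized:
  "phi_lambda (fps_of_poly (trunc_series B s)) \<in> localized g"
proof -
  have "fps_X ^ n \<in> localized g" for n
    using localized_poly[of "Polynomial.monom 1 n" g] by (simp add: fps_of_poly_monom)
  then show ?thesis
    unfolding phi_lambda_trunc_series by (intro localized_sum localized_mult localized_const)
qed

lemma units_of_subring_mult:
  assumes "\<And>x y. x \<in> S \<Longrightarrow> y \<in> S \<Longrightarrow> x * y \<in> S"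
    and "x \<in> units_of_subring S" "y \<in> units_of_subring S"
  shows "x * y \<in> units_of_subring S"
proof -
  obtain a b where "a \<in> S" "x * a = 1" "b \<in> S" "y * b = 1" "x \<in> S" "y \<in> S"
    using assms(2,3) unfolding units_of_subring_def by blast
  moreover from this have "(x * y) * (a * b) = 1"
    by (metis mult.assoc mult.commute mult_1)
  ultimately show ?thesis unfolding units_of_subring_def using assms(1) by blast
qed

section \<open>Convergence to a unit\<close>

theorem theorem7p5:
  fixes B :: "nat \<Rightarrow> 'p::prime_card qring" and p :: nat
  assumes p: "p = CARD('p)" "odd p"
    and nonzero: "\<forall>n. B n \<noteq> 0"
    and a: "\<forall>n m s. \<exists>r.
        to_fract (B (n + m * p ^ (s + 1))) / to_fract (phi (B (n div p + m * p ^ s)))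
          - to_fract (B n) / to_fract (phi (B (n div p)))
        = qbracket (p ^ (s + 1)) * to_fract r"
    and b: "\<forall>n. to_fract (B n) / to_fract (phi (B (n div p))) \<in> range to_fract"
    and d': "B 0 = 1"
  shows "\<exists>u L.
      (\<forall>s. to_fract (fps_of_poly (trunc_series B (s + 1)))
             / to_fract (phi_lambda (fps_of_poly (trunc_series B s))) = to_fract (u s))
      \<and> pq_converges_in (completed (trunc_series B 1)) u L
      \<and> L \<in> units_of_subring (completed (trunc_series B 1))"
proof -
  define F where "F s = fps_of_poly (trunc_series B s)" for s
  define P where "P s = phi_lambda (F s)" for s
  define g where "g = trunc_series B 1"
  have "\<forall>n. \<exists>y. to_fract (B n) / to_fract (phi (B (n div p))) = to_fract y"
    using b by blast
  from choice[OF this] obtain A where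
    A: "\<And>n. to_fract (B n) / to_fract (phi (B (n div p))) = to_fract (A n)" by blast
  have B: "B n = A n * phi (B (n div CARD('p)))" for n
  proof -
    have "to_fract (phi (B (n div p))) \<noteq> 0" using nonzero by simp
    then have "to_fract (B n) = to_fract (A n * phi (B (n div p)))"
      using A[of n] by (simp add: field_simps)
    then show ?thesis by (simp only: to_fract_eq_iff p(1))
  qed
  have A0: "A 0 = 1" using B[of 0] d' by simp
  have A_cont: "A (n + m * CARD('p) ^ Suc j) - A n \<in> base_ideal (Suc j)" for n m j
  proof -
    have "0 < p" by (simp add: p(1) prime_gt_0_nat prime_card)
    then have "(n + m * p ^ (j + 1)) div p = n div p + m * p ^ j"
      by (simp add: mult.left_commute[of m])
    then obtain r where r: "to_fract (A (n + m * p ^ (j + 1))) - to_fract (A n)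
        = qbracket (p ^ (j + 1)) * to_fract r"
      using a[rule_format, of n m j] by (auto simp only: A[symmetric])
    obtain c :: "'p qring" where c: "qbracket (CARD('p) ^ Suc j) = to_fract c" "c \<in> base_ideal (Suc j)"
      by (rule qbracket_p_power)
    have "to_fract (A (n + m * CARD('p) ^ Suc j) - A n) = to_fract (c * r)"
      using r c(1) by (simp add: p(1))
    then have "A (n + m * CARD('p) ^ Suc j) - A n = r * c" by (simp only: to_fract_eq_iff mult.commute)
    then show ?thesis using base_ideal_mult_left[OF c(2)] by simp
  qed
  define h where "h = transfer_op (digit_weight A 0) (\<lambda>_. 1)"
  define L where "L = transfer_sum (\<lambda>k. digit_weight A (k + 1))"
  have FL: "F (Suc s) = L s h" for s
  proof -
    have "F (Suc s) = transfer_sum (\<lambda>k. digit_weight A (k + 0)) (Suc s) (\<lambda>_. 1)"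
      unfolding transfer_sum_digit_weight[OF B d'] by (simp add: F_def fps_of_poly_trunc_series)
    then show ?thesis by (simp add: L_def h_def)
  qed
  have PL: "P s = L s (\<lambda>_. 1)" for s
    unfolding L_def transfer_sum_digit_weight[OF B d']
    by (simp add: P_def F_def phi_lambda_trunc_series)
  have h: "adic_continuous 1 h"
    unfolding h_def using transfer_op_continuous[OF digit_weight_continuous[OF A_cont], of 0] by simp
  have F1: "F 1 = h 0" using FL[of 0] by (simp add: L_def)

  \<comment> \<open>By \<open>FL\<close> and \<open>PL\<close>, these are the transfer sums \<open>L\<close> of \<open>h\<close> and of \<open>1\<close>, over the same digits.\<close>
  have dwork: "F (Suc (Suc s)) * P s - F (Suc s) * P (Suc s) \<in> series_ideal (s + 1)" for s
    unfolding FL PL L_def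
    by (rule transfer_sum_contraction)
      (use h in \<open>simp_all add: digit_weight_continuous[OF A_cont] digit_weight_nth_0[where A=A, OF A0]\<close>)
  have step: "F (Suc s) - F 1 * P s \<in> series_ideal 1" for s
    unfolding F1 FL PL L_def using transfer_sum_near_const[OF h] .

  have "F 1 $ 0 = 1"
    using d' by (simp add: F_def fps_of_poly_trunc_series fps_sum_nth fps_X_power_nth
        mult_delta_right prime_gt_0_nat prime_card)
  then have g: "poly.coeff g 0 dvd 1" by (simp add: F_def g_def)
  let ?T = "completed g" and ?U = "units_of_subring (completed g)"
  have F_T: "F s \<in> ?T" for s
    unfolding F_def by (intro completed_localized[OF g] localized_poly)
  have P_T: "P s \<in> ?T" for s
    unfolding P_def F_def by (intro completed_localized[OF g] phi_lambda_trunc_series_localized)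
  have U_mult: "x \<in> ?U \<Longrightarrow> y \<in> ?U \<Longrightarrow> x * y \<in> ?U" for x y
    by (rule units_of_subring_mult[OF completed_mult[OF g]])
  have U_1: "1 \<in> ?U"
    using completed_1[OF g] unfolding units_of_subring_def by auto
  have F1_U: "F 1 \<in> ?U"
  proof -
    obtain v where v: "F 1 * v = 1" using fps_right_inverse[of "F 1" 1] \<open>F 1 $ 0 = 1\<close> by auto
    then have "v * fps_of_poly g ^ 1 = fps_of_poly 1" by (simp add: F_def g_def mult.commute)
    then have "v \<in> localized g" unfolding localized_def by blast
    with v F_T[of 1] show ?thesis
      using completed_localized[OF g] unfolding units_of_subring_def by blast
  qed
  have P_U_if: "P s \<in> ?U" if "F s \<in> ?U" for s
  proof (rule units_of_completed_lift[OF g])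
    have "F s ^ n \<in> ?U" for n by (induction n) (simp_all add: U_1 U_mult that)
    then show "F s ^ CARD('p) \<in> ?U" .
    show "P s - F s ^ CARD('p) \<in> series_ideal 1"
      unfolding P_def F_def by (rule phi_lambda_trunc_series_cong_power)
  qed (rule P_T)
  \<comment> \<open>Modulo \<open>I\<close>, each series \<open>F s\<close> is a power of \<open>F 1\<close>, by \<open>step\<close> and the Frobenius congruence.\<close>
  have F_U: "F s \<in> ?U" for s
  proof (induction s)
    case 0
    show ?case using U_1 d' by (simp add: F_def fps_of_poly_trunc_series)
  next
    case (Suc s)
    show ?case
      using units_of_completed_lift[OF g U_mult[OF F1_U P_U_if[OF Suc]] F_T step] .
  qed
  have "\<forall>s. \<exists>v. v \<in> ?U \<and> P s * v = 1"
  proof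
    fix s
    obtain v where "v \<in> ?T" "P s * v = 1"
      using P_U_if[OF F_U[of s]] unfolding units_of_subring_def by blast
    then have "v \<in> ?U \<and> P s * v = 1"
      using P_T[of s] unfolding units_of_subring_def by (auto simp: mult.commute)
    then show "\<exists>v. v \<in> ?U \<and> P s * v = 1" ..
  qed
  from choice[OF this] obtain v where v: "\<And>s. v s \<in> ?U" "\<And>s. P s * v s = 1" by blast
  define u where "u s = F (Suc s) * v s" for s
  have u_U: "u s \<in> ?U" for s unfolding u_def by (intro U_mult F_U v)
  then have u_T: "u s \<in> ?T" for s unfolding units_of_subring_def by blast
  have "u (Suc s) - u s = (F (Suc (Suc s)) * P s - F (Suc s) * P (Suc s)) * (v s * v (Suc s))" for s
  proof -
    have "(F (Suc (Suc s)) * P s - F (Suc s) * P (Suc s)) * (v s * v (Suc s))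
        = F (Suc (Suc s)) * v (Suc s) * (P s * v s) - F (Suc s) * v s * (P (Suc s) * v (Suc s))"
      by (simp add: algebra_simps)
    then show ?thesis by (simp add: v u_def)
  qed
  then have "u (Suc s) - u s \<in> series_ideal (s + 1)" for s
    using series_ideal_mult_right[OF dwork[of s]] by simp
  then have "u (Suc s) - u s \<in> series_ideal s" for s
    by (rule series_ideal_mono[rotated]) simp
  then obtain l where l: "\<And>s. l - u s \<in> series_ideal s" using series_complete by blast
  have l_T: "l \<in> ?T"
  proof (rule completed_closed[OF g])
    show "\<exists>y\<in>?T. l - y \<in> series_ideal n" for n using l u_T by (rule bexI)
  qed
  have "to_fract (F (s + 1)) / to_fract (P s) = to_fract (u s)" for s
  proof -
    have "P s \<noteq> 0" using v(2)[of s] by auto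
    moreover have "F (s + 1) = u s * P s" using v(2)[of s] by (simp add: u_def mult_ac)
    ultimately show ?thesis by simp
  qed
  moreover have "pq_converges_in ?T u l"
    unfolding pq_converges_in_def
  proof (intro conjI allI u_T l_T)
    fix k
    have "u s - l \<in> pq_power k ?T" if "s \<ge> k" for s
    proof (rule completed_inter_series_ideal[OF g])
      show "u s - l \<in> ?T" by (rule completed_diff[OF g u_T l_T])
      show "u s - l \<in> series_ideal k"
        using series_ideal_mono[OF that l[of s]] series_ideal_minus_commute[of l "u s" k] by simp
    qed
    then show "\<forall>\<^sub>F s in sequentially. u s - l \<in> pq_power k ?T"
      unfolding eventually_sequentially by blast
  qed
  moreover have "l \<in> ?U"
    using units_of_completed_lift[OF g u_U l_T l] .
  ultimately show ?thesis
    unfolding F_def P_def g_def by blast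
qed

end
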